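(* Let $p>1$ be a known integer and consider the $p$-component two-dimensional sinusoidal model $$y(t,s)=\sum_{k=1}^{p}\Big(A_k^0\cos(\lambda_k^0t+\mu_k^0s)+B_k^0\sin(\lambda_k^0t+\mu_k^0s)\Big)+\epsilon(t,s),\qquad t\in\{1,\dots,T\},\ s\in\{1,\dots,S\},$$ with true parameter $\theta_0=(A_1^0,B_1^0,\lambda_1^0,\mu_1^0,\dots,A_p^0,B_p^0,\lambda_p^0,\mu_p^0)$. Assume: (1) The parameter space is $\Theta=(K\times K\times[0,\pi]\times[0,\pi])^p$, where $K$ is a compact subset of $\mathbb{R}$, and $\theta_0$ is an interior point of $\Theta$. (2) The $\epsilon(t,s)$ are independent and identically distributed random variables with common distribution function $G$ and continuous probability density function $g$, such that $G$ has unique median at $0$, i.e. $G(0)=\tfrac12$; the derivative $g'$ exists and is bounded; and $\mathbb{E}[\epsilon(t,s)^2]<\infty$ for all $t,s$. Let $\hat\theta_{T,S}$ be the least absolute deviation (LAD) estimator of $\theta_0$. Then $\hat\theta_{T,S}$ is strongly consistent for $\theta_0$, i.e. $$\hat\theta_{T,S}\xrightarrow{\text{a.s.}}\theta_0\qquad\text{as }\min\{T,S\}\to\infty.$$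
   Context: The LAD estimator $\hat\theta_{T,S}$ is obtained by minimizing, over $\theta=(A_1,B_1,\lambda_1,\mu_1,\dots,A_p,B_p,\lambda_p,\mu_p)\in\Theta$, the objective function $$Q_{T,S}(\theta)=\frac{1}{TS}\sum_{t=1}^{T}\sum_{s=1}^{S}\Big|y(t,s)-\sum_{k=1}^{p}\big(A_k\cos(\lambda_kt+\mu_ks)+B_k\sin(\lambda_kt+\mu_ks)\big)\Big|,$$ i.e. $\hat\theta_{T,S}=\arg\min_{\theta\in\Theta}Q_{T,S}(\theta)$.
   Formalization: Since the objective is invariant under permuting components, convergence is proved after a suitable renumbering of the components of the estimator; it is also assumed that every (A_k^0,B_k^0) is nonzero and that the frequency pairs (λ_k^0,μ_k^0) are pairwise distinct, as identifiability requires. *)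

theory Defs
  imports "HOL-Probability.Probability"
begin

text \<open>
  A component is the tuple \<open>(A, B, \<lambda>, \<mu>)\<close>; the number of components is \<open>p = CARD('p)\<close>, so
  that a parameter lives in a copy of \<open>\<real>\<^sup>4\<^sup>p\<close> carrying its Euclidean topology.
\<close>

type_synonym component = "real \<times> real \<times> real \<times> real"

definition wave :: "component \<Rightarrow> nat \<Rightarrow> nat \<Rightarrow> real" where
  "wave = (\<lambda>(A, B, l, m) t s.
     A * cos (l * real t + m * real s) + B * sin (l * real t + m * real s))"

definition signal :: "component ^ 'p \<Rightarrow> nat \<Rightarrow> nat \<Rightarrow> real" where
  "signal \<theta> t s = (\<Sum>k\<in>UNIV. wave (\<theta> $ k) t s)"

definition param_space :: "real set \<Rightarrow> (component ^ 'p) set" where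
  "param_space K = {\<theta>. \<forall>k. \<theta> $ k \<in> K \<times> K \<times> {0..pi} \<times> {0..pi}}"

definition lad_objective ::
    "(nat \<Rightarrow> nat \<Rightarrow> real) \<Rightarrow> nat \<Rightarrow> nat \<Rightarrow> component ^ 'p \<Rightarrow> real" where
  "lad_objective y T S \<theta> =
     1 / (real T * real S) * (\<Sum>t=1..T. \<Sum>s=1..S. \<bar>y t s - signal \<theta> t s\<bar>)"

text \<open>
  The minimizer is never unique when \<open>p > 1\<close> (see \<open>relabel\<close>), so being a LAD estimate is a
  predicate rather than a function of the data.
\<close>

definition is_lad_estimate ::
    "real set \<Rightarrow> (nat \<Rightarrow> nat \<Rightarrow> real) \<Rightarrow> nat \<Rightarrow> nat \<Rightarrow> component ^ 'p \<Rightarrow> bool" where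
  "is_lad_estimate K y T S \<theta> \<longleftrightarrow>
     is_arg_min (lad_objective y T S) (\<lambda>\<theta>'. \<theta>' \<in> param_space K) \<theta>"

text \<open>
  The model has exactly \<open>p\<close> components: none of them vanishes and no two share
  their frequency pair. Otherwise two components could be merged, or the frequencies of a
  vanishing one changed, without altering the signal.
\<close>

definition genuine_components :: "component ^ 'p \<Rightarrow> bool" where
  "genuine_components \<theta> \<longleftrightarrow>
     (\<forall>k. case \<theta> $ k of (A, B, _, _) \<Rightarrow> (A, B) \<noteq> (0, 0)) \<and>
     inj (\<lambda>k. case \<theta> $ k of (_, _, l, m) \<Rightarrow> (l, m))"

text \<open>
  Permuting the components changes neither the signal nor membership in the parameter space,
  so the data determine a parameter only up to the numbering of its components.
\<close>

definition relabel :: "('p \<Rightarrow> 'p) \<Rightarrow> component ^ 'p \<Rightarrow> component ^ 'p" where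
  "relabel \<pi> \<theta> = (\<chi> k. \<theta> $ \<pi> k)"

end

theory Submission
  imports Defs "HOL-Real_Asymp.Real_Asymp"
begin

text \<open>
  Replace the criterion by its increment over the true parameter, a mean over the rectangle of
  \<open>\<bar>\<epsilon> + h\<bar> - \<bar>\<epsilon>\<bar>\<close> where \<open>h\<close> is the difference of the signals. These summands are bounded and
  independent, so Hoeffding's inequality gives deviations of probability \<open>exp (- c T S)\<close>. This beats
  the polynomial size of a grid of mesh \<open>1 / (T + S)\<^sup>2\<close> in the parameter space, and Borel--Cantelli
  yields a uniform law of large numbers. Since the median is unique, \<open>\<bar>\<epsilon> + h\<bar> - \<bar>\<epsilon>\<bar>\<close> has positive
  expectation for \<open>h \<noteq> 0\<close>, so the mean square of \<open>h\<close> at the estimate tends to zero.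

  It remains to see that this forces convergence of the parameters. Along a convergent subsequence,
  correlate \<open>h\<close> with the exponential at a true frequency: the coefficient of the true signal does not
  vanish, so some estimated frequency has this limit. The amplitudes still need care, because the
  frequency error may be of order \<open>1 / T\<close>: one only obtains \<open>a\<^sub>0 = a d\<close>, with \<open>d\<close> a limit of exponential
  means. Correlating with the exponential at the estimated frequency gives \<open>a = a\<^sub>0 cnj d\<close>, whence
  \<open>\<bar>d\<bar> = 1\<close>; and exponential means of modulus close to one are close to one.
\<close>

subsection \<open>Means over a rectangle\<close>

text \<open>Stated for normed spaces so that one operator averages both the real summands of the
  criterion and the complex exponentials of the Fourier coefficients.\<close>

definition rect_mean :: "nat \<Rightarrow> nat \<Rightarrow> (nat \<Rightarrow> nat \<Rightarrow> 'b::real_normed_vector) \<Rightarrow> 'b" where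
  "rect_mean T S f = (1 / (real T * real S)) *\<^sub>R (\<Sum>t=1..T. \<Sum>s=1..S. f t s)"

text \<open>A normalised Dirichlet kernel, summed over \<open>1..T\<close> to match the
  criterion.\<close>

definition cis_mean :: "nat \<Rightarrow> real \<Rightarrow> complex" where
  "cis_mean T a = (\<Sum>t=1..T. cis (a * real t)) / of_nat T"

lemma rect_mean_cong:
  "(\<And>t s. t \<in> {1..T} \<Longrightarrow> s \<in> {1..S} \<Longrightarrow> f t s = g t s) \<Longrightarrow> rect_mean T S f = rect_mean T S g"
  unfolding rect_mean_def by (auto intro!: sum.cong arg_cong2[of _ _ _ _ scaleR])

lemma rect_mean_diff: "rect_mean T S (\<lambda>t s. f t s - g t s) = rect_mean T S f - rect_mean T S g"
  by (simp add: rect_mean_def sum_subtractf scaleR_diff_right)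

lemma rect_mean_add: "rect_mean T S (\<lambda>t s. f t s + g t s) = rect_mean T S f + rect_mean T S g"
  by (simp add: rect_mean_def sum.distrib scaleR_add_right)

lemma rect_mean_sum: "rect_mean T S (\<lambda>t s. \<Sum>i\<in>I. f i t s) = (\<Sum>i\<in>I. rect_mean T S (f i))"
proof -
  have "(\<Sum>t=1..T. \<Sum>s=1..S. \<Sum>i\<in>I. f i t s) = (\<Sum>i\<in>I. \<Sum>t=1..T. \<Sum>s=1..S. f i t s)"
    by (simp add: sum.swap[of _ I])
  then show ?thesis by (simp add: rect_mean_def scaleR_sum_right)
qed

lemma rect_mean_mult_left:
  fixes f :: "nat \<Rightarrow> nat \<Rightarrow> 'b::real_normed_algebra"
  shows "rect_mean T S (\<lambda>t s. c * f t s) = c * rect_mean T S f"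
  by (simp add: rect_mean_def sum_distrib_left)

lemma norm_rect_mean_le: "norm (rect_mean T S f) \<le> rect_mean T S (\<lambda>t s. norm (f t s))"
proof -
  have "norm (\<Sum>t=1..T. \<Sum>s=1..S. f t s) \<le> (\<Sum>t=1..T. \<Sum>s=1..S. norm (f t s))"
    by (intro order_trans[OF norm_sum] sum_mono) auto
  then show ?thesis by (simp add: rect_mean_def divide_right_mono)
qed

lemma rect_mean_mono:
  fixes f g :: "nat \<Rightarrow> nat \<Rightarrow> real"
  assumes "\<And>t s. t \<in> {1..T} \<Longrightarrow> s \<in> {1..S} \<Longrightarrow> f t s \<le> g t s"
  shows "rect_mean T S f \<le> rect_mean T S g"
  unfolding rect_mean_def real_scaleR_def
  by (intro mult_left_mono sum_mono) (use assms in auto)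

lemma rect_mean_const: "T \<ge> 1 \<Longrightarrow> S \<ge> 1 \<Longrightarrow> rect_mean T S (\<lambda>_ _. c) = c"
  by (simp add: rect_mean_def sum_constant_scaleR)

text \<open>The variance of \<open>f\<close> over the rectangle is nonnegative.\<close>

lemma rect_mean_square_le:
  fixes f :: "nat \<Rightarrow> nat \<Rightarrow> real"
  assumes "T \<ge> 1" "S \<ge> 1"
  shows "(rect_mean T S f)\<^sup>2 \<le> rect_mean T S (\<lambda>t s. (f t s)\<^sup>2)"
proof -
  let ?m = "rect_mean T S f"
  have "0 \<le> rect_mean T S (\<lambda>t s. (f t s - ?m)\<^sup>2)"
    using rect_mean_mono[of T S "\<lambda>_ _. 0" "\<lambda>t s. (f t s - ?m)\<^sup>2"] by (simp add: rect_mean_def)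
  also have "(\<lambda>t s. (f t s - ?m)\<^sup>2) = (\<lambda>t s. (f t s)\<^sup>2 - (2 * ?m) * f t s + ?m\<^sup>2)"
    by (intro ext) (simp add: power2_eq_square algebra_simps)
  also have "rect_mean T S \<dots> = rect_mean T S (\<lambda>t s. (f t s)\<^sup>2) - ?m\<^sup>2"
    by (simp only: rect_mean_add rect_mean_diff rect_mean_mult_left rect_mean_const[OF assms])
      (simp add: power2_eq_square)
  finally show ?thesis by simp
qed

section \<open>Exponential means\<close>

lemma rect_mean_cis:
  "rect_mean T S (\<lambda>t s. cis (a * real t + b * real s)) = cis_mean T a * cis_mean S b"
  by (simp add: rect_mean_def cis_mean_def cis_mult[symmetric] sum_product scaleR_conv_of_real)

lemma cis_mean_0: "T \<ge> 1 \<Longrightarrow> cis_mean T 0 = 1"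
  by (simp add: cis_mean_def)

lemma cis_mean_uminus: "cis_mean T (- a) = cnj (cis_mean T a)"
  by (simp add: cis_mean_def cis_cnj)

lemma norm_cis_mean_le_1: "norm (cis_mean T a) \<le> 1"
proof -
  have "norm (\<Sum>t=1..T. cis (a * real t)) \<le> (\<Sum>t=1..T. 1)"
    by (intro order_trans[OF norm_sum] sum_mono) auto
  then show ?thesis by (simp add: cis_mean_def norm_divide divide_le_eq)
qed

text \<open>The sum is geometric: multiplication by \<open>cis a - 1\<close> telescopes it to a
  difference of two unit complex numbers.\<close>

lemma norm_cis_mean_le:
  assumes "cis a \<noteq> 1" "T \<ge> 1"
  shows "norm (cis_mean T a) \<le> 2 / (real T * norm (cis a - 1))"
proof -
  have "(cis a - 1) * (\<Sum>t=1..T. cis (a * real t)) = cis (a * real (T + 1)) - cis a"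
  proof (induction T)
    case (Suc n)
    then show ?case by (simp add: algebra_simps cis_mult)
  qed simp
  then have "norm (cis a - 1) * norm (\<Sum>t=1..T. cis (a * real t)) = norm (cis (a * real (T + 1)) - cis a)"
    by (metis norm_mult)
  also have "\<dots> \<le> 2"
    by (rule order_trans[OF norm_triangle_ineq4]) simp
  finally have "norm (\<Sum>t=1..T. cis (a * real t)) \<le> 2 / norm (cis a - 1)"
    using assms by (simp add: field_simps)
  from divide_right_mono[OF this, of "real T"] show ?thesis
    by (simp add: cis_mean_def norm_divide mult.commute)
qed

text \<open>The frequency may vary with \<open>n\<close>, as estimated frequencies do;
  \<open>norm (cis (a n) - 1)\<close> has a positive limit, so the geometric bound is of order
  \<open>1 / T n\<close>.\<close>

lemma cis_mean_tendsto_0: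
  assumes a: "a \<longlonglongrightarrow> a'" and "cis a' \<noteq> 1" and T: "filterlim T at_top sequentially"
  shows "(\<lambda>n. cis_mean (T n) (a n)) \<longlonglongrightarrow> 0"
proof (rule Lim_null_comparison)
  have c: "(\<lambda>n. cis (a n)) \<longlonglongrightarrow> cis a'"
    unfolding cis_conv_exp by (intro tendsto_intros a)
  have "\<forall>\<^sub>F n in sequentially. cis (a n) \<noteq> 1"
    using tendsto_imp_eventually_ne[OF c] assms by auto
  moreover have "\<forall>\<^sub>F n in sequentially. T n \<ge> 1"
    using T by (simp add: filterlim_at_top)
  ultimately show "\<forall>\<^sub>F n in sequentially. norm (cis_mean (T n) (a n))
      \<le> 2 / norm (cis (a n) - 1) * inverse (real (T n))"
  proof eventually_elim
    case (elim n)
    then show ?case using norm_cis_mean_le[of "a n" "T n"] by (simp add: field_simps)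
  qed
  have "(\<lambda>n. inverse (real (T n))) \<longlonglongrightarrow> 0"
    by (rule filterlim_compose[OF tendsto_inverse_0_at_top[OF filterlim_real_sequentially] T])
  moreover have "(\<lambda>n. 2 / norm (cis (a n) - 1)) \<longlonglongrightarrow> 2 / norm (cis a' - 1)"
    by (intro tendsto_intros c) (use assms in auto)
  ultimately show "(\<lambda>n. 2 / norm (cis (a n) - 1) * inverse (real (T n))) \<longlonglongrightarrow> 0"
    using tendsto_mult by fastforce
qed

text \<open>The bound \<open>2 * pi\<close> covers nonzero differences of frequencies in
  \<open>{0..pi}\<close> as well as their sums once one of the two is interior.\<close>

lemma cis_neq_1: "0 < \<bar>x\<bar> \<Longrightarrow> \<bar>x\<bar> < 2 * pi \<Longrightarrow> cis x \<noteq> 1"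
proof
  assume x: "0 < \<bar>x\<bar>" "\<bar>x\<bar> < 2 * pi" and "cis x = 1"
  then have "cos x = 1" by (metis cis.sel(1) one_complex.sel(1))
  then obtain n :: int where n: "x = n * 2 * pi" by (auto simp: cos_one_2pi_int)
  with x have "\<bar>real_of_int n\<bar> * (2 * pi) < 1 * (2 * pi)" by (simp add: abs_mult)
  then have "\<bar>real_of_int n\<bar> < 1" by (subst (asm) mult_less_cancel_right_pos) auto
  then have "n = 0" by linarith
  with n x show False by simp
qed

text \<open>
  If the mean \<open>w\<close> of the \<open>z\<^sup>t\<close> has modulus close to one, then \<open>z\<^sup>t\<close> is mostly close to \<open>w\<close>.
  Comparing \<open>z\<^sup>t\<^sup>+\<^sup>r\<close> with \<open>z\<^sup>t\<close> shows that \<open>z\<^sup>r\<close> is close to one for \<open>r \<le> T / 2\<close>, and then for all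
  \<open>r \<le> T\<close>. The estimate fails for \<open>T = 1\<close>.
\<close>

lemma norm_cis_mean_minus_1_le:
  assumes T: "T \<ge> 2"
  shows "(norm (cis_mean T a - 1))\<^sup>2 \<le> 72 * (1 - (norm (cis_mean T a))\<^sup>2)"
proof -
  define w where "w = cis_mean T a"
  define \<kappa> where "\<kappa> = 1 - (norm w)\<^sup>2"
  define z where "z = (\<lambda>t. cis (a * real t))"
  have z_add: "z (t + r) = z t * z r" for t r by (simp add: z_def cis_mult algebra_simps)
  have nz: "norm (z t) = 1" for t by (simp add: z_def)
  have sz: "(\<Sum>t=1..T. z t) = of_nat T * w" using T by (simp add: w_def cis_mean_def z_def)
  \<comment> \<open>Expanding the square around the mean \<open>w\<close> of unit numbers shows that
    \<open>\<kappa>\<close> is their variance.\<close>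
  have "(\<Sum>t=1..T. (norm (z t - w))\<^sup>2) = (\<Sum>t=1..T. 1 + (norm w)\<^sup>2 - 2 * Re (z t * cnj w))"
  proof (rule sum.cong)
    fix t show "(norm (z t - w))\<^sup>2 = 1 + (norm w)\<^sup>2 - 2 * Re (z t * cnj w)"
      using cmod_power2[of "z t"] unfolding nz cmod_power2
      by (simp add: algebra_simps power2_eq_square)
  qed simp
  also have "\<dots> = real T * (1 + (norm w)\<^sup>2) - 2 * Re ((\<Sum>t=1..T. z t) * cnj w)"
    by (simp add: sum_subtractf sum_distrib_left sum_distrib_right)
  also have "Re ((\<Sum>t=1..T. z t) * cnj w) = real T * (norm w)\<^sup>2"
    unfolding sz cmod_power2 by (simp add: power2_eq_square algebra_simps)
  finally have energy: "(\<Sum>t=1..T. (norm (z t - w))\<^sup>2) = real T * \<kappa>"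
    by (simp add: \<kappa>_def algebra_simps)
  \<comment> \<open>All differences \<open>z (t + r) - z t\<close> have modulus
    \<open>norm (z r - 1)\<close>. Comparing both ends with \<open>w\<close> costs at most
    \<open>4 * T * \<kappa>\<close> in total, and at least \<open>T / 2\<close> values of
    \<open>t\<close> share it: hence \<open>8 * \<kappa>\<close>.\<close>
  have half: "norm (z r - 1) \<le> sqrt (8 * \<kappa>)" if r: "2 * r \<le> T" for r
  proof -
    have "real (T - r) * (norm (z r - 1))\<^sup>2 = (\<Sum>t=1..T-r. (norm (z (t + r) - z t))\<^sup>2)"
    proof -
      have "norm (z (t + r) - z t) = norm (z r - 1)" for t
        using nz[of t] norm_mult[of "z t" "z r - 1"] by (simp add: z_add algebra_simps)
      then show ?thesis by simp
    qed
    also have "\<dots> \<le> (\<Sum>t=1..T-r. 2 * (norm (z (t + r) - w))\<^sup>2 + 2 * (norm (z t - w))\<^sup>2)"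
    proof (rule sum_mono)
      fix t
      have "norm (z (t + r) - z t) \<le> norm (z (t + r) - w) + norm (z t - w)"
        using norm_triangle_ineq4[of "z (t + r) - w" "z t - w"] by simp
      then have "(norm (z (t + r) - z t))\<^sup>2 \<le> (norm (z (t + r) - w) + norm (z t - w))\<^sup>2"
        by (intro power_mono) auto
      also have "\<dots> \<le> 2 * (norm (z (t + r) - w))\<^sup>2 + 2 * (norm (z t - w))\<^sup>2"
        using sum_squares_bound[of "norm (z (t + r) - w)" "norm (z t - w)"]
        by (simp add: power2_sum)
      finally show "(norm (z (t + r) - z t))\<^sup>2
          \<le> 2 * (norm (z (t + r) - w))\<^sup>2 + 2 * (norm (z t - w))\<^sup>2" .
    qed
    also have "\<dots> = 2 * (\<Sum>t=1+r..(T-r)+r. (norm (z t - w))\<^sup>2) + 2 * (\<Sum>t=1..T-r. (norm (z t - w))\<^sup>2)"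
      by (simp only: sum.shift_bounds_cl_nat_ivl sum.distrib sum_distrib_left)
    also have "\<dots> \<le> 2 * (\<Sum>t=1..T. (norm (z t - w))\<^sup>2) + 2 * (\<Sum>t=1..T. (norm (z t - w))\<^sup>2)"
      by (intro add_mono mult_left_mono sum_mono2) auto
    finally have 1: "real (T - r) * (norm (z r - 1))\<^sup>2 \<le> 4 * (real T * \<kappa>)"
      unfolding energy by (simp add: mult_ac)
    have "real T / 2 * (norm (z r - 1))\<^sup>2 \<le> real (T - r) * (norm (z r - 1))\<^sup>2"
      by (intro mult_right_mono) (use r in \<open>auto simp: of_nat_diff\<close>)
    with 1 have "real T * (norm (z r - 1))\<^sup>2 \<le> real T * (8 * \<kappa>)" by simp
    then have "(norm (z r - 1))\<^sup>2 \<le> 8 * \<kappa>" using T by (subst (asm) mult_le_cancel_left_pos) auto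
    then show ?thesis by (rule real_le_rsqrt)
  qed
  have "norm w \<le> 1" unfolding w_def by (rule norm_cis_mean_le_1)
  then have \<kappa>: "\<kappa> \<ge> 0" by (simp add: \<kappa>_def power_le_one)
  \<comment> \<open>Halving: \<open>t = r + r + q\<close> with \<open>q\<close> at most 1 gives
    three terms covered by \<open>half\<close>. The final constant is
    \<open>72 = 9 * 8\<close>.\<close>
  have full: "norm (z t - 1) \<le> 3 * sqrt (8 * \<kappa>)" if t: "t \<le> T" for t
  proof -
    define r where "r = t div 2"
    define q where "q = t mod 2"
    have "t = r + r + q" unfolding r_def q_def by presburger
    then have "norm (z t - 1) = norm ((z r - 1) * (z r * z q) + (z r - 1) * z q + (z q - 1))"
      by (simp add: z_add algebra_simps)
    also have "\<dots> \<le> norm (z r - 1) + norm (z r - 1) + norm (z q - 1)"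
      by (intro norm_triangle_mono order_refl) (simp_all add: norm_mult nz)
    also have "\<dots> \<le> 3 * sqrt (8 * \<kappa>)"
      proof -
      \<comment> \<open>The bound for \<open>q = 1\<close> is where \<open>T \<ge> 2\<close>
        enters.\<close>
      have "2 * r \<le> T" "2 * q \<le> T" using t T unfolding r_def q_def by presburger+
      from half[OF this(1)] half[OF this(2)] show ?thesis by simp
    qed
    finally show ?thesis .
  qed
  have "norm (of_nat T * (w - 1)) = norm (\<Sum>t=1..T. z t - 1)"
    by (simp only: sum_subtractf sz) (simp add: algebra_simps)
  also have "\<dots> \<le> (\<Sum>t=1..T. 3 * sqrt (8 * \<kappa>))"
    by (intro order_trans[OF norm_sum] sum_mono full) auto
  finally have "norm (w - 1) \<le> 3 * sqrt (8 * \<kappa>)" using T by (simp add: norm_mult)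
  then have "(norm (w - 1))\<^sup>2 \<le> (3 * sqrt (8 * \<kappa>))\<^sup>2" by (intro power_mono) auto
  then show ?thesis using \<kappa> by (simp add: w_def \<kappa>_def power_mult_distrib)
qed

subsection \<open>Identification of the parameter\<close>

text \<open>The sign of the imaginary part makes a wave the real part of \<open>amp c\<close> times
  the exponential at \<open>freq c\<close>.\<close>

definition amp :: "component \<Rightarrow> complex" where
  "amp c = Complex (fst c) (- fst (snd c))"

definition freq :: "component \<Rightarrow> real \<times> real" where
  "freq c = snd (snd c)"

text \<open>Two-dimensional Dirichlet kernel: the response at frequency offset \<open>x\<close> to a
  pure exponential.\<close>

definition rect_kernel :: "nat \<Rightarrow> nat \<Rightarrow> real \<times> real \<Rightarrow> complex" where
  "rect_kernel T S x = cis_mean T (fst x) * cis_mean S (snd x)"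

definition fourier :: "nat \<Rightarrow> nat \<Rightarrow> (nat \<Rightarrow> nat \<Rightarrow> real) \<Rightarrow> real \<times> real \<Rightarrow> complex" where
  "fourier T S h x = rect_mean T S (\<lambda>t s. of_real (h t s) * cis (- (fst x * real t + snd x * real s)))"

lemma rect_kernel_0: "T \<ge> 1 \<Longrightarrow> S \<ge> 1 \<Longrightarrow> rect_kernel T S 0 = 1"
  by (simp add: rect_kernel_def cis_mean_0)

lemma rect_kernel_uminus: "rect_kernel T S (- x) = cnj (rect_kernel T S x)"
  by (simp add: rect_kernel_def cis_mean_uminus)

text \<open>One coordinate away from the multiples of \<open>2 * pi\<close> suffices, since the
  other factor is bounded by one.\<close>

lemma rect_kernel_tendsto_0:
  assumes x: "x \<longlonglongrightarrow> x'" and T: "filterlim T at_top sequentially" and S: "filterlim S at_top sequentially"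
    and ne: "cis (fst x') \<noteq> 1 \<or> cis (snd x') \<noteq> 1"
  shows "(\<lambda>n. rect_kernel (T n) (S n) (x n)) \<longlonglongrightarrow> 0"
  using ne
proof
  assume "cis (fst x') \<noteq> 1"
  then have "(\<lambda>n. norm (cis_mean (T n) (fst (x n)))) \<longlonglongrightarrow> 0"
    using cis_mean_tendsto_0[OF tendsto_fst[OF x] _ T] tendsto_norm_zero by blast
  then show ?thesis
    by (rule Lim_null_comparison[rotated])
      (simp add: rect_kernel_def norm_mult mult_left_le norm_cis_mean_le_1)
next
  assume "cis (snd x') \<noteq> 1"
  then have "(\<lambda>n. norm (cis_mean (S n) (snd (x n)))) \<longlonglongrightarrow> 0"
    using cis_mean_tendsto_0[OF tendsto_snd[OF x] _ S] tendsto_norm_zero by blast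
  then show ?thesis
    by (rule Lim_null_comparison[rotated])
      (simp add: rect_kernel_def norm_mult mult_left_le_one_le norm_cis_mean_le_1)
qed

text \<open>For general complex sequences the phase would stay free; here the quantitative estimate
  bounds the distance to one by the defect of the modulus.\<close>

lemma cis_mean_tendsto_1:
  assumes T: "filterlim T at_top sequentially"
    and n: "(\<lambda>n. norm (cis_mean (T n) (a n))) \<longlonglongrightarrow> 1"
  shows "(\<lambda>n. cis_mean (T n) (a n)) \<longlonglongrightarrow> 1"
proof -
  have "\<forall>\<^sub>F n in sequentially. T n \<ge> 2"
    using T by (simp add: filterlim_at_top)
  then have le: "\<forall>\<^sub>F n in sequentially. norm ((norm (cis_mean (T n) (a n) - 1))\<^sup>2)
      \<le> 72 * (1 - (norm (cis_mean (T n) (a n)))\<^sup>2)"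
  proof eventually_elim
    case (elim n)
    then show ?case using norm_cis_mean_minus_1_le[of "T n" "a n"] by simp
  qed
  have "(\<lambda>n. 72 * (1 - (norm (cis_mean (T n) (a n)))\<^sup>2)) \<longlonglongrightarrow> 72 * (1 - 1\<^sup>2)"
    by (intro tendsto_intros n)
  then have "(\<lambda>n. 72 * (1 - (norm (cis_mean (T n) (a n)))\<^sup>2)) \<longlonglongrightarrow> 0" by simp
  from Lim_null_comparison[OF le this]
  have "(\<lambda>n. cis_mean (T n) (a n) - 1) \<longlonglongrightarrow> 0"
    by (simp add: tendsto_norm_zero_iff)
  then show ?thesis by (simp add: LIM_zero_iff)
qed

text \<open>Both factors have modulus at most one, so each modulus is squeezed between that of the
  product and one.\<close>

lemma rect_kernel_tendsto_1:
  assumes T: "filterlim T at_top sequentially" and S: "filterlim S at_top sequentially"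
    and n: "(\<lambda>n. norm (rect_kernel (T n) (S n) (x n))) \<longlonglongrightarrow> 1"
  shows "(\<lambda>n. rect_kernel (T n) (S n) (x n)) \<longlonglongrightarrow> 1"
proof -
  have "(\<lambda>n. norm (cis_mean (T n) (fst (x n)))) \<longlonglongrightarrow> 1"
    by (rule tendsto_sandwich[OF _ _ n tendsto_const])
      (simp_all add: rect_kernel_def norm_mult mult_left_le norm_cis_mean_le_1)
  moreover have "(\<lambda>n. norm (cis_mean (S n) (snd (x n)))) \<longlonglongrightarrow> 1"
    by (rule tendsto_sandwich[OF _ _ n tendsto_const])
      (simp_all add: rect_kernel_def norm_mult mult_left_le_one_le norm_cis_mean_le_1)
  ultimately have "(\<lambda>n. cis_mean (T n) (fst (x n)) * cis_mean (S n) (snd (x n))) \<longlonglongrightarrow> 1 * 1"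
    by (intro tendsto_mult cis_mean_tendsto_1 T S)
  then show ?thesis by (simp add: rect_kernel_def)
qed

section \<open>Fourier coefficients of waves and signals\<close>

lemma wave_conv_cis:
  "complex_of_real (wave c t s) =
    amp c / 2 * cis (fst (freq c) * real t + snd (freq c) * real s) +
    cnj (amp c) / 2 * cis (- (fst (freq c) * real t + snd (freq c) * real s))"
proof -
  define \<phi> where "\<phi> = fst (freq c) * real t + snd (freq c) * real s"
  have "wave c t s = fst c * cos \<phi> + fst (snd c) * sin \<phi>"
    by (cases c) (simp add: wave_def \<phi>_def freq_def)
  then show ?thesis
    by (simp add: \<phi>_def[symmetric] amp_def complex_eq_iff diff_divide_distrib)
qed

text \<open>A real wave is a sum of exponentials at \<open>freq c\<close> and at its mirror image
  \<open>- freq c\<close>, each contributing the kernel at its offset from \<open>x\<close>.\<close>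

lemma fourier_wave:
  "fourier T S (wave c) x =
    amp c / 2 * rect_kernel T S (freq c - x) + cnj (amp c) / 2 * rect_kernel T S (- (freq c + x))"
proof -
  let ?l = "fst (freq c)" and ?m = "snd (freq c)" and ?a = "fst x" and ?b = "snd x"
  have "fourier T S (wave c) x = rect_mean T S (\<lambda>t s.
      amp c / 2 * cis ((?l - ?a) * real t + (?m - ?b) * real s) +
      cnj (amp c) / 2 * cis (- (?l + ?a) * real t + - (?m + ?b) * real s))"
    unfolding fourier_def wave_conv_cis
    by (intro rect_mean_cong) (simp add: distrib_right mult.assoc cis_mult algebra_simps)
  also have "\<dots> = amp c / 2 * rect_kernel T S (freq c - x) + cnj (amp c) / 2 * rect_kernel T S (- (freq c + x))"
    by (simp only: rect_mean_add rect_mean_mult_left rect_mean_cis rect_kernel_def fst_diff snd_diff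
        fst_add snd_add fst_uminus snd_uminus)
  finally show ?thesis .
qed

lemma fourier_diff: "fourier T S (\<lambda>t s. f t s - g t s) x = fourier T S f x - fourier T S g x"
  by (simp add: fourier_def left_diff_distrib rect_mean_diff)

lemma fourier_signal: "fourier T S (signal \<theta>) x = (\<Sum>k\<in>UNIV. fourier T S (wave (\<theta> $ k)) x)"
  by (simp add: fourier_def signal_def sum_distrib_right rect_mean_sum)

text \<open>Bessel's inequality for a single exponential. It is uniform in \<open>x\<close>, so a
  small mean square controls the coefficient even at a frequency that moves with
  \<open>n\<close>.\<close>

lemma norm_fourier_square_le:
  assumes "T \<ge> 1" "S \<ge> 1"
  shows "(norm (fourier T S h x))\<^sup>2 \<le> rect_mean T S (\<lambda>t s. (h t s)\<^sup>2)"
proof -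
  have "norm (fourier T S h x) \<le> rect_mean T S (\<lambda>t s. \<bar>h t s\<bar>)"
    unfolding fourier_def by (rule order_trans[OF norm_rect_mean_le]) (simp add: norm_mult)
  then have "(norm (fourier T S h x))\<^sup>2 \<le> (rect_mean T S (\<lambda>t s. \<bar>h t s\<bar>))\<^sup>2"
    by (intro power_mono) auto
  also have "\<dots> \<le> rect_mean T S (\<lambda>t s. \<bar>h t s\<bar>\<^sup>2)"
    by (rule rect_mean_square_le[OF assms])
  finally show ?thesis by simp
qed

lemma tendsto_amp: "c \<longlonglongrightarrow> c' \<Longrightarrow> (\<lambda>n. amp (c n)) \<longlonglongrightarrow> amp c'"
  unfolding amp_def by (intro tendsto_intros)

lemma tendsto_freq: "c \<longlonglongrightarrow> c' \<Longrightarrow> (\<lambda>n. freq (c n)) \<longlonglongrightarrow> freq c'"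
  unfolding freq_def by (intro tendsto_intros)

text \<open>Only the mirror term is dropped: as \<open>x'\<close> is interior, the sum of
  frequencies stays strictly between 0 and \<open>2 * pi\<close> in the limit. The other kernel is
  kept because its offset may tend to zero, where its behaviour depends on the rate.\<close>

lemma fourier_wave_asymp:
  assumes c: "c \<longlonglongrightarrow> c'" and x: "x \<longlonglongrightarrow> x'"
    and T: "filterlim T at_top sequentially" and S: "filterlim S at_top sequentially"
    and c': "freq c' \<in> {0..pi} \<times> {0..pi}" and x': "x' \<in> {0<..<pi} \<times> {0<..<pi}"
  shows "(\<lambda>n. fourier (T n) (S n) (wave (c n)) (x n) -
            amp (c n) / 2 * rect_kernel (T n) (S n) (freq (c n) - x n)) \<longlonglongrightarrow> 0"
proof -
  have "(\<lambda>n. - (freq (c n) + x n)) \<longlonglongrightarrow> - (freq c' + x')"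
    by (intro tendsto_intros tendsto_freq c x)
  moreover have "cis (fst (- (freq c' + x'))) \<noteq> 1"
    using c' x' by (intro cis_neq_1) (auto simp: mem_Times_iff)
  ultimately have k: "(\<lambda>n. rect_kernel (T n) (S n) (- (freq (c n) + x n))) \<longlonglongrightarrow> 0"
    by (intro rect_kernel_tendsto_0 T S) auto
  have "(\<lambda>n. cnj (amp (c n)) / 2 * rect_kernel (T n) (S n) (- (freq (c n) + x n))) \<longlonglongrightarrow> cnj (amp c') / 2 * 0"
    by (intro tendsto_intros tendsto_amp c k) simp
  then show ?thesis by (simp add: fourier_wave)
qed

text \<open>Some coordinate of the offset has a nonzero limit of modulus at most \<open>pi\<close>,
  so the direct term vanishes as well.\<close>

lemma fourier_wave_tendsto_0:
  assumes c: "c \<longlonglongrightarrow> c'" and x: "x \<longlonglongrightarrow> x'"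
    and T: "filterlim T at_top sequentially" and S: "filterlim S at_top sequentially"
    and c': "freq c' \<in> {0..pi} \<times> {0..pi}" and x': "x' \<in> {0<..<pi} \<times> {0<..<pi}"
    and ne: "freq c' \<noteq> x'"
  shows "(\<lambda>n. fourier (T n) (S n) (wave (c n)) (x n)) \<longlonglongrightarrow> 0"
proof -
  have "cis (fst (freq c' - x')) \<noteq> 1 \<or> cis (snd (freq c' - x')) \<noteq> 1"
  proof (cases "fst (freq c') = fst x'")
    case True
    then have "snd (freq c') \<noteq> snd x'" using ne by (auto simp: prod_eq_iff)
    then show ?thesis
      using c' x' by (intro disjI2 cis_neq_1) (auto simp: mem_Times_iff)
  next
    case False
    then show ?thesis
      using c' x' by (intro disjI1 cis_neq_1) (auto simp: mem_Times_iff)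
  qed
  moreover have "(\<lambda>n. freq (c n) - x n) \<longlonglongrightarrow> freq c' - x'"
    by (intro tendsto_intros tendsto_freq c x)
  ultimately have k: "(\<lambda>n. rect_kernel (T n) (S n) (freq (c n) - x n)) \<longlonglongrightarrow> 0"
    by (intro rect_kernel_tendsto_0 T S) auto
  have "(\<lambda>n. amp (c n) / 2 * rect_kernel (T n) (S n) (freq (c n) - x n)) \<longlonglongrightarrow> amp c' / 2 * 0"
    by (intro tendsto_intros tendsto_amp c k) simp
  from tendsto_add[OF fourier_wave_asymp[OF c x T S c' x'] this] show ?thesis by simp
qed

lemma fourier_signal_tendsto_0:
  assumes \<theta>: "\<theta> \<longlonglongrightarrow> \<theta>'" and x: "x \<longlonglongrightarrow> x'"
    and T: "filterlim T at_top sequentially" and S: "filterlim S at_top sequentially"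
    and \<theta>': "\<And>j. freq (\<theta>' $ j) \<in> {0..pi} \<times> {0..pi}" and x': "x' \<in> {0<..<pi} \<times> {0<..<pi}"
    and ne: "\<And>j. freq (\<theta>' $ j) \<noteq> x'"
  shows "(\<lambda>n. fourier (T n) (S n) (signal (\<theta> n)) (x n)) \<longlonglongrightarrow> 0"
  unfolding fourier_signal
  by (intro tendsto_null_sum fourier_wave_tendsto_0[OF tendsto_vec_nth[OF \<theta>] x T S \<theta>' x' ne])

text \<open>Components whose frequencies have other limits drop out, so only component
  \<open>i\<close> can be seen at \<open>x\<close>; the sequence \<open>x\<close> may be the
  estimated frequency itself.\<close>

lemma fourier_signal_asymp:
  assumes \<theta>: "\<theta> \<longlonglongrightarrow> \<theta>'" and x: "x \<longlonglongrightarrow> x'"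
    and T: "filterlim T at_top sequentially" and S: "filterlim S at_top sequentially"
    and \<theta>': "\<And>j. freq (\<theta>' $ j) \<in> {0..pi} \<times> {0..pi}" and x': "x' \<in> {0<..<pi} \<times> {0<..<pi}"
    and ne: "\<And>j. j \<noteq> i \<Longrightarrow> freq (\<theta>' $ j) \<noteq> x'"
  shows "(\<lambda>n. fourier (T n) (S n) (signal (\<theta> n)) (x n) -
            amp (\<theta> n $ i) / 2 * rect_kernel (T n) (S n) (freq (\<theta> n $ i) - x n)) \<longlonglongrightarrow> 0"
proof -
  have \<theta>i: "(\<lambda>n. \<theta> n $ j) \<longlonglongrightarrow> \<theta>' $ j" for j by (rule tendsto_vec_nth[OF \<theta>])
  have "(\<lambda>n. (fourier (T n) (S n) (wave (\<theta> n $ i)) (x n) -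
            amp (\<theta> n $ i) / 2 * rect_kernel (T n) (S n) (freq (\<theta> n $ i) - x n)) +
          (\<Sum>j\<in>UNIV - {i}. fourier (T n) (S n) (wave (\<theta> n $ j)) (x n))) \<longlonglongrightarrow> 0 + 0"
    by (intro tendsto_add tendsto_null_sum fourier_wave_asymp[OF \<theta>i x T S \<theta>' x']
        fourier_wave_tendsto_0[OF \<theta>i x T S \<theta>' x' ne]) auto
  then show ?thesis
    unfolding fourier_signal by (subst sum.remove[of UNIV i]) (simp_all add: algebra_simps)
qed

text \<open>Each true frequency must be the limit of an estimated one; with equally many components
  the matching is bijective and none is left over. Correlating at the true and at the estimated
  frequency then pins down the amplitudes.\<close>

lemma relabel_eq_limit:
  fixes \<theta>\<^sub>0 \<theta>' :: "component ^ 'p"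
  assumes \<theta>: "\<theta> \<longlonglongrightarrow> \<theta>'"
    and T: "filterlim T at_top sequentially" and S: "filterlim S at_top sequentially"
    and \<theta>': "\<And>j. freq (\<theta>' $ j) \<in> {0..pi} \<times> {0..pi}"
    and genuine: "genuine_components \<theta>\<^sub>0"
    and \<theta>\<^sub>0: "\<And>k. freq (\<theta>\<^sub>0 $ k) \<in> {0<..<pi} \<times> {0<..<pi}"
    and ms: "(\<lambda>n. rect_mean (T n) (S n) (\<lambda>t s. (signal \<theta>\<^sub>0 t s - signal (\<theta> n) t s)\<^sup>2)) \<longlonglongrightarrow> 0"
  shows "\<exists>\<pi>. bij \<pi> \<and> relabel \<pi> \<theta>' = \<theta>\<^sub>0"
proof -
  have amp0: "amp (\<theta>\<^sub>0 $ k) \<noteq> 0" for k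
    using genuine by (cases "\<theta>\<^sub>0 $ k") (fastforce simp: genuine_components_def amp_def complex_eq_iff split: prod.splits)
  have inj0: "inj (\<lambda>k. freq (\<theta>\<^sub>0 $ k))"
  proof -
    have "(\<lambda>k. case \<theta>\<^sub>0 $ k of (_, _, l, m) \<Rightarrow> (l, m)) = (\<lambda>k. freq (\<theta>\<^sub>0 $ k))"
      by (auto simp: freq_def split: prod.splits)
    then show ?thesis using genuine by (simp add: genuine_components_def)
  qed
  have \<theta>\<^sub>0': "freq (\<theta>\<^sub>0 $ k) \<in> {0..pi} \<times> {0..pi}" for k
    using \<theta>\<^sub>0[of k] by (auto simp: mem_Times_iff)
  have ev1: "\<forall>\<^sub>F n in sequentially. T n \<ge> 1 \<and> S n \<ge> 1"
    using T S by (simp add: filterlim_at_top eventually_conj)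
  \<comment> \<open>Here \<open>x\<close> is an arbitrary sequence: it may be a constant true
    frequency, but also the moving estimated one.\<close>
  have null: "(\<lambda>n. fourier (T n) (S n) (signal \<theta>\<^sub>0) (x n) - fourier (T n) (S n) (signal (\<theta> n)) (x n)) \<longlonglongrightarrow> 0"
    for x
  proof -
    have "(\<lambda>n. (norm (fourier (T n) (S n) (\<lambda>t s. signal \<theta>\<^sub>0 t s - signal (\<theta> n) t s) (x n)))\<^sup>2) \<longlonglongrightarrow> 0"
      by (rule Lim_null_comparison[OF _ ms], use ev1 in eventually_elim)
        (simp add: norm_fourier_square_le)
    then show ?thesis by (simp add: tendsto_norm_zero_iff fourier_diff)
  qed
  have kernel0: "(\<lambda>n. rect_kernel (T n) (S n) 0) \<longlonglongrightarrow> 1"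
    by (rule tendsto_eventually, use ev1 in eventually_elim) (simp add: rect_kernel_0)
  have coeff0: "(\<lambda>n. fourier (T n) (S n) (signal \<theta>\<^sub>0) (freq (\<theta>\<^sub>0 $ k))) \<longlonglongrightarrow> amp (\<theta>\<^sub>0 $ k) / 2" for k
  proof -
    have "(\<lambda>n. fourier (T n) (S n) (signal \<theta>\<^sub>0) (freq (\<theta>\<^sub>0 $ k)) -
            amp (\<theta>\<^sub>0 $ k) / 2 * rect_kernel (T n) (S n) (freq (\<theta>\<^sub>0 $ k) - freq (\<theta>\<^sub>0 $ k))) \<longlonglongrightarrow> 0"
      by (rule fourier_signal_asymp[OF tendsto_const tendsto_const T S \<theta>\<^sub>0' \<theta>\<^sub>0])
        (use inj0 in \<open>auto dest: injD\<close>)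
    moreover have "(\<lambda>n. amp (\<theta>\<^sub>0 $ k) / 2 * rect_kernel (T n) (S n) (freq (\<theta>\<^sub>0 $ k) - freq (\<theta>\<^sub>0 $ k)))
        \<longlonglongrightarrow> amp (\<theta>\<^sub>0 $ k) / 2 * 1"
      using kernel0 by (intro tendsto_mult tendsto_const) simp
    ultimately show ?thesis using tendsto_add by fastforce
  qed
  \<comment> \<open>Otherwise the coefficient of the true signal would tend to zero, yet its limit
    is half a nonvanishing amplitude.\<close>
  have "\<exists>j. freq (\<theta>' $ j) = freq (\<theta>\<^sub>0 $ k)" for k
  proof (rule ccontr)
    assume "\<not> ?thesis"
    then have "(\<lambda>n. fourier (T n) (S n) (signal (\<theta> n)) (freq (\<theta>\<^sub>0 $ k))) \<longlonglongrightarrow> 0"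
      by (intro fourier_signal_tendsto_0[OF \<theta> tendsto_const T S \<theta>' \<theta>\<^sub>0]) auto
    from tendsto_add[OF null[of "\<lambda>_. freq (\<theta>\<^sub>0 $ k)"] this]
    have "(\<lambda>n. fourier (T n) (S n) (signal \<theta>\<^sub>0) (freq (\<theta>\<^sub>0 $ k))) \<longlonglongrightarrow> 0" by simp
    from LIMSEQ_unique[OF this coeff0] amp0[of k] show False by simp
  qed
  then obtain \<pi> where \<pi>: "\<And>k. freq (\<theta>' $ \<pi> k) = freq (\<theta>\<^sub>0 $ k)" by metis
  \<comment> \<open>Distinct true frequencies make \<open>\<pi>\<close> injective, and finiteness of
    the index type makes it bijective.\<close>
  have "inj \<pi>" by (rule injI) (metis \<pi> inj0 injD)
  then have bij: "bij \<pi>" by (simp add: bij_def finite_UNIV_inj_surj)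
  have other: "freq (\<theta>' $ j) \<noteq> freq (\<theta>\<^sub>0 $ k)" if "j \<noteq> \<pi> k" for j k
    using that bij \<pi> inj0 by (metis bij_pointE injD)
  have "\<theta>' $ \<pi> k = \<theta>\<^sub>0 $ k" for k
  proof -
    let ?b = "amp (\<theta>\<^sub>0 $ k)" and ?a = "amp (\<theta>' $ \<pi> k)"
    let ?xn = "\<lambda>n. freq (\<theta> n $ \<pi> k)" and ?x = "freq (\<theta>\<^sub>0 $ k)"
    let ?d = "\<lambda>n. rect_kernel (T n) (S n) (?xn n - ?x)"
    have \<theta>k: "(\<lambda>n. \<theta> n $ \<pi> k) \<longlonglongrightarrow> \<theta>' $ \<pi> k" by (rule tendsto_vec_nth[OF \<theta>])
    have xn: "?xn \<longlonglongrightarrow> ?x" using tendsto_freq[OF \<theta>k] by (simp add: \<pi>)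
    have an: "(\<lambda>n. amp (\<theta> n $ \<pi> k)) \<longlonglongrightarrow> ?a" by (rule tendsto_amp[OF \<theta>k])
    have 1: "(\<lambda>n. fourier (T n) (S n) (signal (\<theta> n)) ?x - amp (\<theta> n $ \<pi> k) / 2 * ?d n) \<longlonglongrightarrow> 0"
      by (rule fourier_signal_asymp[OF \<theta> tendsto_const T S \<theta>' \<theta>\<^sub>0 other])
    \<comment> \<open>At the true frequency: \<open>?b\<close> is the limit of
      \<open>amp (\<theta> n $ \<pi> k) * ?d n\<close>, where \<open>?d\<close> is not yet known to
      converge.\<close>
    have A1: "(\<lambda>n. amp (\<theta> n $ \<pi> k) / 2 * ?d n) \<longlonglongrightarrow> ?b / 2"
      using tendsto_diff[OF tendsto_diff[OF coeff0[of k] null[of "\<lambda>_. ?x"]] 1]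
      by simp
    have 2: "(\<lambda>n. fourier (T n) (S n) (signal (\<theta> n)) (?xn n) -
        amp (\<theta> n $ \<pi> k) / 2 * rect_kernel (T n) (S n) (?xn n - ?xn n)) \<longlonglongrightarrow> 0"
      by (rule fourier_signal_asymp[OF \<theta> xn T S \<theta>' \<theta>\<^sub>0 other])
    have 3: "(\<lambda>n. fourier (T n) (S n) (signal \<theta>\<^sub>0) (?xn n) -
        ?b / 2 * rect_kernel (T n) (S n) (?x - ?xn n)) \<longlonglongrightarrow> 0"
      by (rule fourier_signal_asymp[OF tendsto_const xn T S \<theta>\<^sub>0' \<theta>\<^sub>0])
        (use inj0 in \<open>auto dest: injD\<close>)
    have 4: "(\<lambda>n. amp (\<theta> n $ \<pi> k) / 2 * rect_kernel (T n) (S n) (?xn n - ?xn n)) \<longlonglongrightarrow> ?a / 2 * 1"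
      using kernel0 by (intro tendsto_intros an) auto
    have cd: "rect_kernel (T n) (S n) (?x - ?xn n) = cnj (?d n)" for n
      using rect_kernel_uminus[of "T n" "S n" "?xn n - ?x"] by simp
    \<comment> \<open>At the estimated frequency the roles are exchanged: the kernel of the
      estimated component tends to one and the true component carries \<open>cnj (?d n)\<close>.
      Since \<open>?b\<close> is nonzero, this makes \<open>?d\<close> converge.\<close>
    have "(\<lambda>n. ?b / 2 * cnj (?d n)) \<longlonglongrightarrow> ?a / 2"
      using tendsto_add[OF tendsto_add[OF 2 4] tendsto_diff[OF null[of ?xn] 3]] by (simp add: cd)
    from tendsto_mult[OF tendsto_const[of "2 / ?b"] this]
    have "(\<lambda>n. cnj (?d n)) \<longlonglongrightarrow> ?a / ?b" using amp0[of k] by simp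
    then have d: "?d \<longlonglongrightarrow> cnj (?a / ?b)" using tendsto_cnj by fastforce
    have "(\<lambda>n. amp (\<theta> n $ \<pi> k) / 2 * ?d n) \<longlonglongrightarrow> ?a / 2 * cnj (?a / ?b)"
      by (intro tendsto_intros an d) simp
    \<comment> \<open>The two relations force \<open>norm ?a = norm ?b\<close>, hence
      \<open>norm (?d n)\<close> tends to one, and the rigidity of the kernel turns this into
      \<open>?d\<close> tending to one.\<close>
    from LIMSEQ_unique[OF A1 this] have eq: "?b = ?a * cnj (?a / ?b)" by simp
    then have "norm ?b = norm ?a * (norm ?a / norm ?b)"
      by (metis norm_mult complex_mod_cnj norm_divide)
    then have "(norm ?b)\<^sup>2 = (norm ?a)\<^sup>2"
      using amp0[of k] by (simp add: field_simps power2_eq_square)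
    then have "norm ?b = norm ?a" by simp
    moreover from this have "?a \<noteq> 0" using amp0[of k] by auto
    ultimately have "norm (cnj (?a / ?b)) = 1" by (simp add: norm_divide)
    with tendsto_norm[OF d] have "?d \<longlonglongrightarrow> 1" by (intro rect_kernel_tendsto_1 T S) simp
    from LIMSEQ_unique[OF d this] eq have "?b = ?a" by simp
    then show ?thesis
      using \<pi>[of k] by (simp add: amp_def freq_def prod_eq_iff)
  qed
  then have "relabel \<pi> \<theta>' = \<theta>\<^sub>0" by (simp add: relabel_def vec_eq_iff)
  with bij show ?thesis by blast
qed

section \<open>Compactness and interior of the parameter space\<close>

lemma param_spaceD:
  assumes "\<theta> \<in> param_space K"
  shows "freq (\<theta> $ k) \<in> {0..pi} \<times> {0..pi}" "fst (\<theta> $ k) \<in> K" "fst (snd (\<theta> $ k)) \<in> K"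
  using assms by (auto simp: param_space_def freq_def mem_Times_iff)

lemma compact_cart:
  fixes C :: "'b::{heine_borel,real_normed_vector} set"
  assumes "compact C"
  shows "compact {x :: 'b ^ 'n. \<forall>i. x $ i \<in> C}"
proof (subst compact_eq_bounded_closed, intro conjI)
  obtain B where B: "\<And>y. y \<in> C \<Longrightarrow> norm y \<le> B"
    using compact_imp_bounded[OF assms] by (auto simp: bounded_iff)
  show "bounded {x :: 'b ^ 'n. \<forall>i. x $ i \<in> C}"
  proof (rule boundedI)
    fix x :: "'b ^ 'n" assume "x \<in> {x. \<forall>i. x $ i \<in> C}"
    then have "(\<Sum>i\<in>UNIV. norm (x $ i)) \<le> (\<Sum>i\<in>(UNIV::'n set). B)"
      by (intro sum_mono B) auto
    moreover have "norm x \<le> (\<Sum>i\<in>UNIV. norm (x $ i))"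
      unfolding norm_vec_def by (rule L2_set_le_sum) simp
    ultimately show "norm x \<le> (\<Sum>i\<in>(UNIV::'n set). B)" by linarith
  qed
  show "closed {x :: 'b ^ 'n. \<forall>i. x $ i \<in> C}"
    by (rule closed_vector_box) (simp add: assms compact_imp_closed)
qed

lemma compact_param_space: "compact K \<Longrightarrow> compact (param_space K)"
  unfolding param_space_def by (intro compact_cart compact_Times) auto

text \<open>Shifting both frequencies of component \<open>k\<close> by the same small
  \<open>u\<close>, of either sign, stays inside the parameter space.\<close>

lemma interior_param_space_freq:
  fixes \<theta> :: "component ^ 'p"
  assumes "\<theta> \<in> interior (param_space K)"
  shows "freq (\<theta> $ k) \<in> {0<..<pi} \<times> {0<..<pi}"
proof -
  obtain e where e: "e > 0" "ball \<theta> e \<subseteq> param_space K"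
    using assms by (auto simp: mem_interior)
  \<comment> \<open>The shift has norm at most \<open>2 * e / 3\<close>, hence stays in the
    ball.\<close>
  have "freq (\<theta> $ k) + (u, u) \<in> {0..pi} \<times> {0..pi}" if u: "\<bar>u\<bar> = e / 3" for u
  proof -
    let ?v = "(0, 0, u, u) :: component"
    have "norm ?v \<le> \<bar>u\<bar> + \<bar>u\<bar>"
      using norm_Pair_le[of u u] by (simp add: norm_Pair)
    moreover have "norm (axis k ?v) \<le> (\<Sum>i\<in>UNIV. norm (axis k ?v $ i))"
      unfolding norm_vec_def by (rule L2_set_le_sum) simp
    moreover have "(\<Sum>i\<in>UNIV. norm (axis k ?v $ i)) = norm ?v"
      by (subst sum.remove[of UNIV k]) (auto simp: axis_def intro!: sum.neutral)
    ultimately have "norm (axis k ?v) < e" using u e by simp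
    then have "\<theta> + axis k ?v \<in> param_space K" using e by (auto simp: dist_norm)
    from param_spaceD(1)[OF this, of k] show ?thesis
      by (simp add: freq_def axis_def)
  qed
  from this[of "e / 3"] this[of "- (e / 3)"] e show ?thesis
    by (auto simp: mem_Times_iff)
qed

text \<open>By compactness: counterexamples with \<open>\<kappa>\<close> tending to 0 and
  \<open>N\<close> to infinity have a convergent subsequence, whose limit is
  \<open>\<theta>\<^sub>0\<close> up to relabelling. The statement is free of randomness, so
  \<open>\<kappa>\<close> and \<open>N\<close> serve every outcome.\<close>

lemma identification:
  fixes \<theta>\<^sub>0 :: "component ^ 'p"
  assumes K: "compact K" and interior: "\<theta>\<^sub>0 \<in> interior (param_space K)"
    and genuine: "genuine_components \<theta>\<^sub>0" and "\<delta> > 0"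
  shows "\<exists>\<kappa>>0. \<exists>N. \<forall>T\<ge>N. \<forall>S\<ge>N. \<forall>\<theta>\<in>param_space K.
    rect_mean T S (\<lambda>t s. (signal \<theta>\<^sub>0 t s - signal \<theta> t s)\<^sup>2) \<le> \<kappa> \<longrightarrow>
    (\<exists>\<pi>. bij \<pi> \<and> dist (relabel \<pi> \<theta>) \<theta>\<^sub>0 < \<delta>)" (is ?goal)
proof (rule ccontr)
  let ?ms = "\<lambda>T S \<theta>. rect_mean T S (\<lambda>t s. (signal \<theta>\<^sub>0 t s - signal \<theta> t s)\<^sup>2)"
  assume contr: "\<not> ?thesis"
  define Q where "Q n T S \<theta> \<longleftrightarrow> T \<ge> n \<and> S \<ge> n \<and> \<theta> \<in> param_space K \<and> ?ms T S \<theta> \<le> inverse (real (Suc n)) \<and>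
      (\<forall>\<pi>. bij \<pi> \<longrightarrow> dist (relabel \<pi> \<theta>) \<theta>\<^sub>0 \<ge> \<delta>)" for n T S \<theta>
  have "\<exists>T S \<theta>. Q n T S \<theta>" for n
  proof -
    have "\<not> (\<exists>N. \<forall>T\<ge>N. \<forall>S\<ge>N. \<forall>\<theta>\<in>param_space K. ?ms T S \<theta> \<le> inverse (real (Suc n)) \<longrightarrow>
        (\<exists>\<pi>. bij \<pi> \<and> dist (relabel \<pi> \<theta>) \<theta>\<^sub>0 < \<delta>))" (is "\<not> ?P")
    proof (rule notI)
      assume ?P
      then have ?goal by (intro exI[of _ "inverse (real (Suc n))"]) simp
      with contr show False ..
    qed
    then show ?thesis unfolding Q_def by (meson not_less)
  qed
  then have "\<forall>n. \<exists>T S \<theta>. Q n T S \<theta>" ..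
  from choice[OF this] obtain T where "\<forall>n. \<exists>S \<theta>. Q n (T n) S \<theta>" ..
  from choice[OF this] obtain S where "\<forall>n. \<exists>\<theta>. Q n (T n) (S n) \<theta>" ..
  from choice[OF this] obtain \<theta> where Q: "\<forall>n. Q n (T n) (S n) (\<theta> n)" ..
  have TS: "T n \<ge> n" "S n \<ge> n" and \<theta>K: "\<theta> n \<in> param_space K"
    and ms: "?ms (T n) (S n) (\<theta> n) \<le> inverse (real (Suc n))"
    and far: "\<And>\<pi>. bij \<pi> \<Longrightarrow> dist (relabel \<pi> (\<theta> n)) \<theta>\<^sub>0 \<ge> \<delta>" for n
    using Q[THEN spec, of n] by (simp_all add: Q_def)
  obtain \<theta>' r where \<theta>': "\<theta>' \<in> param_space K" and r: "strict_mono (r :: nat \<Rightarrow> nat)"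
    and lim: "(\<theta> \<circ> r) \<longlonglongrightarrow> \<theta>'"
    using compact_param_space[OF K] \<theta>K unfolding compact_def by metis
  have r_top: "filterlim r at_top sequentially" by (rule filterlim_subseq[OF r])
  have "filterlim T at_top sequentially" "filterlim S at_top sequentially"
    by (rule filterlim_at_top_mono[OF filterlim_ident]; use TS in simp)+
  then have T: "filterlim (T \<circ> r) at_top sequentially" and S: "filterlim (S \<circ> r) at_top sequentially"
    using r_top filterlim_compose unfolding comp_def by blast+
  have "(\<lambda>n. ?ms (T n) (S n) (\<theta> n)) \<longlonglongrightarrow> 0"
  proof (rule tendsto_sandwich[OF _ _ tendsto_const LIMSEQ_inverse_real_of_nat])
    show "\<forall>\<^sub>F n in sequentially. 0 \<le> ?ms (T n) (S n) (\<theta> n)"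
      by (auto simp: rect_mean_def intro!: always_eventually sum_nonneg divide_nonneg_nonneg)
  qed (use ms in simp)
  then have ms0: "(\<lambda>n. ?ms ((T \<circ> r) n) ((S \<circ> r) n) ((\<theta> \<circ> r) n)) \<longlonglongrightarrow> 0"
    using LIMSEQ_subseq_LIMSEQ[OF _ r] by (fastforce simp: comp_def)
  obtain \<pi> where \<pi>: "bij \<pi>" "relabel \<pi> \<theta>' = \<theta>\<^sub>0"
    using relabel_eq_limit[OF lim T S param_spaceD(1)[OF \<theta>'] genuine
        interior_param_space_freq[OF interior] ms0] by blast
  \<comment> \<open>The permutation found for the limit also works along the subsequence, since
    relabelling is continuous.\<close>
  have "(\<lambda>n. relabel \<pi> ((\<theta> \<circ> r) n)) \<longlonglongrightarrow> relabel \<pi> \<theta>'"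
    unfolding relabel_def by (intro vec_tendstoI) (use tendsto_vec_nth[OF lim] in \<open>simp add: comp_def\<close>)
  then have "(\<lambda>n. dist (relabel \<pi> ((\<theta> \<circ> r) n)) \<theta>\<^sub>0) \<longlonglongrightarrow> 0"
    using \<pi> tendsto_dist_iff by metis
  then have "\<forall>\<^sub>F n in sequentially. dist (relabel \<pi> ((\<theta> \<circ> r) n)) \<theta>\<^sub>0 < \<delta>"
    using \<open>\<delta> > 0\<close> by (rule order_tendstoD)
  then obtain n where "dist (relabel \<pi> ((\<theta> \<circ> r) n)) \<theta>\<^sub>0 < \<delta>"
    using eventually_happens'[OF sequentially_bot] by blast
  then show False using far[OF \<pi>(1), of "r n"] by simp
qed

subsection \<open>Expected excess of the absolute error\<close>

text \<open>Subtracting the absolute value of \<open>x\<close> leaves a quantity bounded by that of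
  \<open>h\<close>; integrability and Hoeffding's inequality rest on this.\<close>

definition excess :: "real \<Rightarrow> real \<Rightarrow> real" where
  "excess x h = \<bar>x + h\<bar> - \<bar>x\<bar>"

definition mean_excess :: "real measure \<Rightarrow> real \<Rightarrow> real" where
  "mean_excess P h = (\<integral>x. excess x h \<partial>P)"

lemma abs_excess_le: "\<bar>excess x h\<bar> \<le> \<bar>h\<bar>"
  by (simp add: excess_def)

lemma abs_excess_diff_le: "\<bar>excess x h - excess x h'\<bar> \<le> \<bar>h - h'\<bar>"
  by (simp add: excess_def)

lemma measurable_excess [measurable]: "(\<lambda>x. excess x h) \<in> borel_measurable borel"
  unfolding excess_def by measurable

context real_distribution
begin

lemma integrable_excess: "integrable M (\<lambda>x. excess x h)"
  by (rule integrable_const_bound[of _ "\<bar>h\<bar>"]) (auto simp: abs_excess_le)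

lemma abs_mean_excess_diff_le: "\<bar>mean_excess M h - mean_excess M h'\<bar> \<le> \<bar>h - h'\<bar>"
proof -
  have "\<bar>mean_excess M h - mean_excess M h'\<bar> = \<bar>\<integral>x. excess x h - excess x h' \<partial>M\<bar>"
    by (simp add: mean_excess_def integrable_excess)
  also have "\<dots> \<le> (\<integral>x. \<bar>excess x h - excess x h'\<bar> \<partial>M)"
    using integral_norm_bound[of M "\<lambda>x. excess x h - excess x h'"] by simp
  also have "\<dots> \<le> (\<integral>x. \<bar>h - h'\<bar> \<partial>M)"
    by (intro integral_mono) (auto simp: integrable_excess abs_excess_diff_le)
  finally show ?thesis using prob_space by simp
qed

lemma mean_excess_0: "mean_excess M 0 = 0"
  by (simp add: mean_excess_def excess_def)

lemma continuous_on_mean_excess: "continuous_on A (mean_excess M)"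
proof (rule continuous_onI)
  fix x e :: real assume "0 < e"
  then show "\<exists>d>0. \<forall>x'\<in>A. dist x' x < d \<longrightarrow> dist (mean_excess M x') (mean_excess M x) \<le> e"
    by (intro exI[of _ e]) (auto simp: dist_real_def intro: order_trans[OF abs_mean_excess_diff_le])
qed

text \<open>For \<open>h > 0\<close> the excess is \<open>h\<close> right of 0 and at least
  \<open>- h\<close> left of it; these halves cancel as both have mass 1/2. On
  \<open>{- h / 2<..0}\<close> the excess is even nonnegative, a gain of \<open>h\<close> on a set
  whose mass is positive because 0 is the only median.\<close>

lemma mean_excess_pos:
  assumes median: "\<And>x. cdf M x = 1 / 2 \<longleftrightarrow> x = 0" and "h \<noteq> 0"
  shows "mean_excess M h > 0"
proof -
  have cdf0: "measure M {..0} = 1 / 2" using median[of 0] by (simp add: cdf_def)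
  have pos: "measure M {0<..} = 1 / 2"
  proof -
    have "{0<..} = space M - {..0}" by auto
    then show ?thesis using prob_compl[of "{..0}"] by (simp add: cdf0)
  qed
  have ind: "integrable M (indicator A :: real \<Rightarrow> real)" if "A \<in> sets borel" for A
    by (rule integrable_const_bound[of _ 1]) (use that in \<open>auto simp: indicator_def\<close>)
  have int: "integrable M (indicator {0<..} :: real \<Rightarrow> real)" "integrable M (indicator {..0} :: real \<Rightarrow> real)"
    "integrable M (indicator {a<..b} :: real \<Rightarrow> real)" for a b
    by (rule ind, simp)+
  consider "h > 0" | "h < 0" using \<open>h \<noteq> 0\<close> by linarith
  then show ?thesis
  proof cases
    case 1
    have "0 < h * (measure M {0<..} - measure M {..0} + measure M {- h / 2<..0})"
    proof -
      have "cdf M (- h / 2) \<le> cdf M 0" by (rule cdf_nondecreasing) (use 1 in simp)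
      moreover have "cdf M (- h / 2) \<noteq> 1 / 2" using median[of "- h / 2"] 1 by simp
      moreover have "measure M {- h / 2<..0} = cdf M 0 - cdf M (- h / 2)"
        by (rule cdf_diff_eq[symmetric]) (use 1 in simp)
      ultimately show ?thesis using 1 median[of 0] by (simp add: pos cdf0)
    qed
    also have "\<dots> = (\<integral>x. h * (indicator {0<..} x - indicator {..0} x + indicator {- h / 2<..0} x) \<partial>M)"
      by (simp add: int)
    also have "\<dots> \<le> mean_excess M h"
      unfolding mean_excess_def
    proof (intro integral_mono integrable_excess)
      show "integrable M (\<lambda>x. h * (indicator {0<..} x - indicator {..0} x + indicator {- h / 2<..0} x))"
        by (intro integrable_mult_right Bochner_Integration.integrable_add Bochner_Integration.integrable_diff int)
      show "h * (indicator {0<..} x - indicator {..0} x + indicator {- h / 2<..0} x) \<le> excess x h" for x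
        using 1 by (simp add: excess_def indicator_def; arith)
    qed
    finally show ?thesis .
  next
    case 2
    \<comment> \<open>Mirror image of the first case, with the gain on
      \<open>{0<..- h / 2}\<close>.\<close>
    have "0 < - h * (measure M {..0} - measure M {0<..} + measure M {0<..- h / 2})"
    proof -
      have "cdf M 0 \<le> cdf M (- h / 2)" by (rule cdf_nondecreasing) (use 2 in simp)
      moreover have "cdf M (- h / 2) \<noteq> 1 / 2" using median[of "- h / 2"] 2 by simp
      moreover have "measure M {0<..- h / 2} = cdf M (- h / 2) - cdf M 0"
        by (rule cdf_diff_eq[symmetric]) (use 2 in simp)
      ultimately show ?thesis using 2 median[of 0] by (simp add: pos cdf0 mult_less_0_iff)
    qed
    also have "\<dots> = (\<integral>x. - h * (indicator {..0} x - indicator {0<..} x + indicator {0<..- h / 2} x) \<partial>M)"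
      by (simp add: int)
    also have "\<dots> \<le> mean_excess M h"
      unfolding mean_excess_def
    proof (intro integral_mono integrable_excess)
      show "integrable M (\<lambda>x. - h * (indicator {..0} x - indicator {0<..} x + indicator {0<..- h / 2} x))"
        by (intro integrable_mult_right Bochner_Integration.integrable_add Bochner_Integration.integrable_diff int)
      show "- h * (indicator {..0} x - indicator {0<..} x + indicator {0<..- h / 2} x) \<le> excess x h" for x
        using 2 by (simp add: excess_def indicator_def; arith)
    qed
    finally show ?thesis .
  qed
qed

text \<open>For \<open>h\<close> with square between \<open>\<eta>\<close> and the square of
  \<open>H\<close>, the continuous positive function \<open>mean_excess M\<close> has a positive
  minimum by compactness; smaller \<open>h\<close> are absorbed by \<open>\<eta>\<close>. Averaged
  over the rectangle, this turns a small expected excess into a small mean square.\<close>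

lemma square_le_mean_excess:
  assumes median: "\<And>x. cdf M x = 1 / 2 \<longleftrightarrow> x = 0" and "\<eta> > 0"
  shows "\<exists>C>0. \<forall>h. \<bar>h\<bar> \<le> H \<longrightarrow> h\<^sup>2 \<le> \<eta> + C * mean_excess M h"
proof -
  let ?D = "{- H.. - sqrt \<eta>} \<union> {sqrt \<eta>..H}"
  have nonneg: "mean_excess M h \<ge> 0" for h
    using mean_excess_pos[OF median] mean_excess_0 by (cases "h = 0") (auto simp: less_imp_le)
  have "\<exists>c>0. \<forall>h\<in>?D. c \<le> mean_excess M h"
  proof (cases "?D = {}")
    case False
    have "compact ?D" by (intro compact_Un) auto
    from continuous_attains_inf[OF this False continuous_on_mean_excess]
    obtain h0 where "h0 \<in> ?D" "\<forall>h\<in>?D. mean_excess M h0 \<le> mean_excess M h" ..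
    moreover from this have "h0 \<noteq> 0" using \<open>\<eta> > 0\<close> by auto
    ultimately show ?thesis using mean_excess_pos[OF median] by blast
  qed (auto intro: exI[of _ 1])
  then obtain c where c: "c > 0" "\<And>h. h \<in> ?D \<Longrightarrow> c \<le> mean_excess M h" by blast
  \<comment> \<open>The summand 1 keeps the constant positive when \<open>H = 0\<close>.\<close>
  have "h\<^sup>2 \<le> \<eta> + (H\<^sup>2 / c + 1) * mean_excess M h" if h: "\<bar>h\<bar> \<le> H" for h
  proof (cases "h \<in> ?D")
    case True
    have "h\<^sup>2 \<le> H\<^sup>2" using h abs_le_square_iff[of h H] by simp
    also have "\<dots> = H\<^sup>2 / c * c" using c by simp
    also have "\<dots> \<le> H\<^sup>2 / c * mean_excess M h" using c True by (intro mult_left_mono) auto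
    finally show ?thesis using nonneg[of h] \<open>\<eta> > 0\<close> by (simp add: distrib_right)
  next
    case False
    then have "\<bar>h\<bar> \<le> sqrt \<eta>" using h by auto
    then have "h\<^sup>2 \<le> \<eta>" using real_sqrt_le_iff[of "h\<^sup>2" \<eta>] by simp
    moreover have "0 \<le> (H\<^sup>2 / c + 1) * mean_excess M h" using c nonneg[of h] by simp
    ultimately show ?thesis by linarith
  qed
  moreover have "H\<^sup>2 / c + 1 > 0" using c by (simp add: add_nonneg_pos)
  ultimately show ?thesis by blast
qed

end

section \<open>Deviation bounds and Borel--Cantelli\<close>

text \<open>Hoeffding's inequality for \<open>T * S\<close> independent summands in an interval of
  length \<open>2 * H\<close>, at threshold \<open>\<eta> * T * S\<close>.\<close>

lemma (in prob_space) prob_rect_mean_excess_ge: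
  assumes indep: "indep_vars (\<lambda>_. borel) (\<lambda>(t, s). \<epsilon> t s) ({1..} \<times> {1..})"
    and distr: "\<And>t s. t \<ge> 1 \<Longrightarrow> s \<ge> 1 \<Longrightarrow> distr M borel (\<epsilon> t s) = P"
    and h: "\<And>t s. \<bar>h t s\<bar> \<le> H" and "H > 0" and "T \<ge> 1" "S \<ge> 1" and "\<eta> > 0"
  shows "prob {\<omega>\<in>space M. \<eta> \<le> \<bar>rect_mean T S (\<lambda>t s. excess (\<epsilon> t s \<omega>) (h t s) - mean_excess P (h t s))\<bar>}
    \<le> 2 * exp (- (\<eta>\<^sup>2 / (2 * H\<^sup>2)) * (real T * real S))"
proof -
  let ?I = "{1..T} \<times> {1..S}"
  let ?X = "\<lambda>(t, s) \<omega>. excess (\<epsilon> t s \<omega>) (h t s)"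
  have rv: "random_variable borel (\<epsilon> t s)" if "t \<ge> 1" "s \<ge> 1" for t s
    using indep that unfolding indep_vars_def by fastforce
  have E: "expectation (?X (t, s)) = mean_excess P (h t s)" if "t \<ge> 1" "s \<ge> 1" for t s
    using integral_distr[OF rv[OF that] measurable_excess, of "h t s"]
    by (simp add: distr[OF that] mean_excess_def)
  interpret Hoeffding_ineq M ?I ?X "\<lambda>_. - H" "\<lambda>_. H" "\<Sum>i\<in>?I. expectation (?X i)"
  proof unfold_locales
    have "indep_vars (\<lambda>_. borel) (\<lambda>(t, s). \<epsilon> t s) ?I"
      by (rule indep_vars_subset[OF indep]) auto
    then have "indep_vars (\<lambda>_. borel) (\<lambda>i \<omega>. (\<lambda>x. excess x (h (fst i) (snd i))) ((\<lambda>(t, s). \<epsilon> t s) i \<omega>)) ?I"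
      by (rule indep_vars_compose2) auto
    then show "indep_vars (\<lambda>_. borel) ?X ?I" by (simp add: case_prod_beta')
    fix i assume "i \<in> ?I"
    show "AE \<omega> in M. ?X i \<omega> \<in> {- H..H}"
      using order_trans[OF abs_excess_le h] by (auto simp: abs_le_iff minus_le_iff split: prod.splits)
  qed auto
  have mean: "rect_mean T S (\<lambda>t s. excess (\<epsilon> t s \<omega>) (h t s) - mean_excess P (h t s)) =
      ((\<Sum>i\<in>?I. ?X i \<omega>) - (\<Sum>i\<in>?I. expectation (?X i))) / (real T * real S)" for \<omega>
  proof -
    have "(\<Sum>i\<in>?I. ?X i \<omega>) = (\<Sum>t=1..T. \<Sum>s=1..S. excess (\<epsilon> t s \<omega>) (h t s))"
      by (simp add: sum.cartesian_product case_prod_beta')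
    moreover have "(\<Sum>i\<in>?I. expectation (?X i)) = (\<Sum>i\<in>?I. mean_excess P (h (fst i) (snd i)))"
      using E by (intro sum.cong) auto
    then have "(\<Sum>i\<in>?I. expectation (?X i)) = (\<Sum>t=1..T. \<Sum>s=1..S. mean_excess P (h t s))"
      by (simp add: sum.cartesian_product case_prod_beta')
    ultimately show ?thesis by (simp add: rect_mean_def sum_subtractf)
  qed
  have exponent: "- 2 * (\<eta> * (real T * real S))\<^sup>2 / (\<Sum>i\<in>?I. (H - - H)\<^sup>2) =
      - (\<eta>\<^sup>2 / (2 * H\<^sup>2)) * (real T * real S)"
  proof -
    have *: "- 2 * (e * n\<^sup>2) / (n * (4 * k)) = - (e / (2 * k)) * n" if "n > 0" "k > 0" for e n k :: real
      using that by (simp add: power2_eq_square)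
    have sum: "(\<Sum>i\<in>?I. (H - - H)\<^sup>2) = real T * real S * (4 * H\<^sup>2)"
      by (simp add: power2_eq_square)
    show ?thesis
      unfolding sum power_mult_distrib[of \<eta> "real T * real S"] by (rule *) (use assms in auto)
  qed
  have event: "{\<omega>\<in>space M. \<eta> \<le> \<bar>rect_mean T S (\<lambda>t s. excess (\<epsilon> t s \<omega>) (h t s) - mean_excess P (h t s))\<bar>} =
      {\<omega>\<in>space M. \<bar>(\<Sum>i\<in>?I. ?X i \<omega>) - (\<Sum>i\<in>?I. expectation (?X i))\<bar> \<ge> \<eta> * (real T * real S)}"
    using assms unfolding mean by (simp add: abs_divide pos_le_divide_eq)
  show ?thesis
    unfolding event exponent[symmetric]
    by (rule Hoeffding_ineq_abs_ge) (use assms in \<open>auto simp: less_le\<close>)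
qed

text \<open>Half of the exponential rate absorbs the power, leaving a geometric series.\<close>

lemma summable_power_mult_exp:
  assumes "c > (0::real)"
  shows "summable (\<lambda>N. real N ^ q * exp (- c * real N))"
proof (rule summable_comparison_test_bigo)
  show "summable (\<lambda>N. norm (exp (- (c / 2)) ^ N))"
    using assms by (simp add: summable_geometric)
  have "(\<lambda>N. real N ^ q * exp (- c * real N)) \<in> O(\<lambda>N. exp (- (c / 2) * real N))"
    using assms by real_asymp
  then show "(\<lambda>N. real N ^ q * exp (- c * real N)) \<in> O(\<lambda>N. exp (- (c / 2)) ^ N)"
    by (simp add: exp_of_nat_mult[symmetric] mult.commute)
qed

text \<open>Union bound and Borel--Cantelli along \<open>N = T + S\<close>: there are fewer than
  \<open>N\<close> rectangles and polynomially many indices, against a probability exponentially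
  small in \<open>T * S\<close>, which is at least \<open>N / 2\<close>.\<close>

lemma (in prob_space) AE_rect_mean_excess_less:
  fixes h :: "'i \<Rightarrow> nat \<Rightarrow> nat \<Rightarrow> real" and F :: "nat \<Rightarrow> 'i set"
  assumes indep: "indep_vars (\<lambda>_. borel) (\<lambda>(t, s). \<epsilon> t s) ({1..} \<times> {1..})"
    and distr: "\<And>t s. t \<ge> 1 \<Longrightarrow> s \<ge> 1 \<Longrightarrow> distr M borel (\<epsilon> t s) = P"
    and fin: "\<And>N. finite (F N)" and card: "\<And>N. N \<ge> 1 \<Longrightarrow> real (card (F N)) \<le> C * real N ^ q"
    and h: "\<And>N i t s. i \<in> F N \<Longrightarrow> \<bar>h i t s\<bar> \<le> H" and "H > 0" and "\<eta> > 0"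
  shows "AE \<omega> in M. \<forall>\<^sub>F N in sequentially. \<forall>T\<ge>1. \<forall>S\<ge>1. T + S = N \<longrightarrow> (\<forall>i\<in>F N.
    \<bar>rect_mean T S (\<lambda>t s. excess (\<epsilon> t s \<omega>) (h i t s) - mean_excess P (h i t s))\<bar> < \<eta>)"
proof -
  let ?dev = "\<lambda>T S i \<omega>. \<bar>rect_mean T S (\<lambda>t s. excess (\<epsilon> t s \<omega>) (h i t s) - mean_excess P (h i t s))\<bar>"
  define c where "c = \<eta>\<^sup>2 / (2 * H\<^sup>2)"
  have "c > 0" using assms by (simp add: c_def)
  \<comment> \<open>Grouping the rectangles by \<open>T + S\<close> leaves one event per
    \<open>N\<close>, as Borel--Cantelli for sequences requires.\<close>
  define A where "A N = (\<Union>(T, i)\<in>{1..<N} \<times> F N. {\<omega>\<in>space M. \<eta> \<le> ?dev T (N - T) i \<omega>})" for N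
  have rv: "random_variable borel (\<epsilon> t s)" if "t \<ge> 1" "s \<ge> 1" for t s
    using indep that unfolding indep_vars_def by fastforce
  have meas: "{\<omega>\<in>space M. \<eta> \<le> ?dev T S i \<omega>} \<in> sets M" for T S i
  proof -
    have "(\<lambda>\<omega>. excess (\<epsilon> t s \<omega>) (h i t s)) \<in> borel_measurable M" if "t \<in> {1..T}" "s \<in> {1..S}" for t s
      by (rule measurable_compose[OF rv measurable_excess]) (use that in auto)
    then have "(\<lambda>\<omega>. ?dev T S i \<omega>) \<in> borel_measurable M"
      unfolding rect_mean_def
      by (intro borel_measurable_abs borel_measurable_scaleR borel_measurable_const
          borel_measurable_sum borel_measurable_diff)
    then show ?thesis by measurable
  qed
  have A: "A N \<in> sets M" for N
    unfolding A_def using fin meas by (intro sets.finite_UN) auto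
  have "prob (A N) \<le> 2 * C * (real N ^ Suc q * exp (- (c / 2) * real N))" for N
  proof (cases "N \<ge> 2")
    case True
    have "prob (A N) \<le> (\<Sum>(T, i)\<in>{1..<N} \<times> F N. prob {\<omega>\<in>space M. \<eta> \<le> ?dev T (N - T) i \<omega>})"
      unfolding A_def case_prod_beta
      by (rule finite_measure_subadditive_finite) (use fin meas in auto)
    also have "\<dots> \<le> (\<Sum>(T, i)\<in>{1..<N} \<times> F N. 2 * exp (- (c / 2) * real N))"
    proof (rule sum_mono, clarify)
      fix T i assume T: "T \<in> {1..<N}" and i: "i \<in> F N"
      \<comment> \<open>With \<open>S = N - T\<close> this yields \<open>T * S \<ge> N - 1\<close>,
        which is at least \<open>N / 2\<close> because \<open>N \<ge> 2\<close>.\<close>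
      have "(real T - 1) * (real (N - T) - 1) \<ge> 0"
        using T by (intro mult_nonneg_nonneg) auto
      then have "real N - 1 \<le> real T * real (N - T)"
        using T by (simp add: of_nat_diff algebra_simps)
      then have "real N / 2 \<le> real T * real (N - T)" using True by linarith
      then have le: "- c * (real T * real (N - T)) \<le> - (c / 2) * real N"
        using mult_left_mono[of "real N / 2" "real T * real (N - T)" c] \<open>c > 0\<close> by simp
      have "prob {\<omega>\<in>space M. \<eta> \<le> ?dev T (N - T) i \<omega>} \<le> 2 * exp (- c * (real T * real (N - T)))"
        unfolding c_def
        by (rule prob_rect_mean_excess_ge[OF indep distr h[OF i]]) (use T assms in auto)
      also have "\<dots> \<le> 2 * exp (- (c / 2) * real N)" using le by simp
      finally show "prob {\<omega>\<in>space M. \<eta> \<le> ?dev T (N - T) i \<omega>} \<le> 2 * exp (- (c / 2) * real N)" .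
    qed
    also have "\<dots> = real (N - 1) * real (card (F N)) * (2 * exp (- (c / 2) * real N))"
      by (simp add: case_prod_beta card_cartesian_product)
    also have "\<dots> \<le> real N * (C * real N ^ q) * (2 * exp (- (c / 2) * real N))"
      using True card[of N] by (intro mult_right_mono mult_mono) simp_all
    finally show ?thesis by (simp add: mult_ac)
  next
    case False
    then have "A N = {}" by (auto simp: A_def)
    \<comment> \<open>The sign of \<open>C\<close> follows from the cardinality bound at
      \<open>N = 1\<close>.\<close>
    moreover have "0 \<le> C" using order_trans[OF of_nat_0_le_iff card[of 1]] by simp
    ultimately show ?thesis by simp
  qed
  then have "norm (prob (A N)) \<le> 2 * C * (real N ^ Suc q * exp (- (c / 2) * real N))" for N
    by simp
  moreover have "summable (\<lambda>N. 2 * C * (real N ^ Suc q * exp (- (c / 2) * real N)))"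
    by (intro summable_mult summable_power_mult_exp) (use \<open>c > 0\<close> in simp)
  ultimately have "summable (\<lambda>N. prob (A N))"
    by (rule summable_comparison_test'[rotated])
  then have "AE \<omega> in M. \<forall>\<^sub>F N in sequentially. \<omega> \<in> space M - A N"
    by (intro borel_cantelli_AE1 A) (simp_all add: emeasure_eq_measure)
  then show ?thesis
  proof eventually_elim
    case (elim \<omega>)
    then show ?case
    proof eventually_elim
      case (elim N)
      show ?case
      proof (intro allI impI ballI)
        fix T S i assume TS: "T \<ge> 1" "S \<ge> 1" "T + S = N" and i: "i \<in> F N"
        then have "(T, i) \<in> {1..<N} \<times> F N" "S = N - T" by auto
        with elim have "\<not> \<eta> \<le> ?dev T S i \<omega>" unfolding A_def by blast
        then show "?dev T S i \<omega> < \<eta>" by simp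
      qed
    qed
  qed
qed

subsection \<open>Discretisation of the parameter space\<close>

text \<open>A cube with the same set in all four coordinates. Grid points need not lie in
  \<open>param_space K\<close>, where \<open>K\<close> may have gaps, so the uniform law is proved
  on a surrounding cube instead.\<close>

definition coeff_box :: "real set \<Rightarrow> (component ^ 'p) set" where
  "coeff_box A = {\<theta>. \<forall>k. \<theta> $ k \<in> A \<times> A \<times> A \<times> A}"

lemma coeff_box_mono: "A \<subseteq> B \<Longrightarrow> coeff_box A \<subseteq> coeff_box B"
  unfolding coeff_box_def by (intro Collect_mono allI impI) (auto simp: mem_Times_iff)

text \<open>The mesh is the inverse square of \<open>N\<close> because a phase
  \<open>l * t + m * s\<close> with \<open>t + s \<le> N\<close> magnifies a frequency error by up
  to \<open>N\<close>, which leaves an error of order \<open>1 / N\<close>.\<close>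

definition grid :: "nat \<Rightarrow> nat \<Rightarrow> real set" where
  "grid R N = (\<lambda>i. real_of_int i / (real N)\<^sup>2) ` {- int (R * N\<^sup>2)..int (R * N\<^sup>2)}"

lemma finite_grid: "finite (grid R N)"
  by (simp add: grid_def)

lemma card_grid_le:
  assumes "N \<ge> 1"
  shows "card (grid R N) \<le> (2 * R + 1) * N\<^sup>2"
proof -
  have card: "card {- int m..int m} = 2 * m + 1" for m
    by simp
  have "card (grid R N) \<le> card {- int (R * N\<^sup>2)..int (R * N\<^sup>2)}"
    unfolding grid_def by (rule card_image_le) simp
  also have "\<dots> = 2 * (R * N\<^sup>2) + 1" by (rule card)
  also have "\<dots> \<le> (2 * R + 1) * N\<^sup>2" using assms by (simp add: algebra_simps)
  finally show ?thesis .
qed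

lemma grid_subset: "grid R N \<subseteq> {- real R..real R}"
proof (cases "N = 0")
  case False
  show ?thesis
  proof (unfold grid_def, rule image_subsetI)
    fix i assume "i \<in> {- int (R * N\<^sup>2)..int (R * N\<^sup>2)}"
    then have "real_of_int (- int (R * N\<^sup>2)) \<le> real_of_int i" "real_of_int i \<le> real_of_int (int (R * N\<^sup>2))"
      unfolding of_int_le_iff by auto
    then show "real_of_int i / (real N)\<^sup>2 \<in> {- real R..real R}"
      using False by (simp add: divide_le_eq le_divide_eq)
  qed
qed (auto simp: grid_def)

lemma grid_approx:
  assumes "\<bar>x\<bar> \<le> real R" "N \<ge> 1"
  shows "\<exists>y\<in>grid R N. \<bar>x - y\<bar> \<le> 1 / (real N)\<^sup>2"
proof -
  let ?y = "\<lfloor>x * (real N)\<^sup>2\<rfloor>"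
  have N: "(real N)\<^sup>2 > 0" using assms by simp
  have "x * (real N)\<^sup>2 \<le> real R * (real N)\<^sup>2" "- real R * (real N)\<^sup>2 \<le> x * (real N)\<^sup>2"
    using assms by (intro mult_right_mono; simp)+
  then have "?y \<le> int (R * N\<^sup>2)" "- int (R * N\<^sup>2) \<le> ?y"
    by (simp_all add: le_floor_iff floor_le_iff)
  then have y: "real_of_int ?y / (real N)\<^sup>2 \<in> grid R N"
    unfolding grid_def by (intro imageI) simp
  have "\<bar>x * (real N)\<^sup>2 - real_of_int ?y\<bar> \<le> 1" by linarith
  then have "\<bar>x * (real N)\<^sup>2 - real_of_int ?y\<bar> / (real N)\<^sup>2 \<le> 1 / (real N)\<^sup>2"
    by (rule divide_right_mono) simp
  moreover have "x - real_of_int ?y / (real N)\<^sup>2 = (x * (real N)\<^sup>2 - real_of_int ?y) / (real N)\<^sup>2"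
    using N by (simp add: diff_divide_distrib)
  ultimately have "\<bar>x - real_of_int ?y / (real N)\<^sup>2\<bar> \<le> 1 / (real N)\<^sup>2"
    by simp
  with y show ?thesis by blast
qed

text \<open>The exponent is the number of real coordinates of a parameter; what matters is that the
  count over the grid is polynomial in \<open>N\<close>.\<close>

lemma coeff_box_card:
  assumes "finite A"
  shows "finite (coeff_box A :: (component ^ 'p) set)"
    and "card (coeff_box A :: (component ^ 'p) set) \<le> card A ^ (4 * CARD('p))"
proof -
  let ?F = "PiE (UNIV :: 'p set) (\<lambda>_. A \<times> A \<times> A \<times> A)"
  have sub: "coeff_box A \<subseteq> (vec_lambda ` ?F :: (component ^ 'p) set)"
  proof
    fix \<theta> :: "component ^ 'p" assume "\<theta> \<in> coeff_box A"
    then have "vec_nth \<theta> \<in> ?F" by (auto simp: coeff_box_def)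
    then show "\<theta> \<in> vec_lambda ` ?F" by (metis imageI vec_nth_inverse)
  qed
  have fin: "finite ?F" using assms by (intro finite_PiE) auto
  show "finite (coeff_box A :: (component ^ 'p) set)"
    using sub fin finite_subset by blast
  have "card (coeff_box A :: (component ^ 'p) set) \<le> card ?F"
    using card_mono[OF _ sub] card_image_le[OF fin, of vec_lambda] fin by force
  also have "card ?F = card A ^ (4 * CARD('p))"
  proof -
    have "card (A \<times> A \<times> A \<times> A) = card A ^ 4"
      by (simp add: card_cartesian_product power4_eq_xxxx mult.assoc)
    then show ?thesis by (simp only: card_PiE[OF finite] prod_constant power_mult)
  qed
  finally show "card (coeff_box A :: (component ^ 'p) set) \<le> card A ^ (4 * CARD('p))" .
qed

section \<open>Dependence of the signal on the parameter\<close>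

lemma abs_cos_diff_le: "\<bar>cos x - cos y\<bar> \<le> \<bar>x - y :: real\<bar>"
proof -
  have "\<bar>cos x - cos y\<bar> = 2 * (\<bar>sin ((x + y) / 2)\<bar> * \<bar>sin ((y - x) / 2)\<bar>)"
    unfolding cos_diff_cos by (simp add: abs_mult)
  also have "\<dots> \<le> 2 * (1 * \<bar>(y - x) / 2\<bar>)"
    by (intro mult_left_mono mult_mono abs_sin_x_le_abs_x) auto
  finally show ?thesis by simp
qed

lemma abs_sin_diff_le: "\<bar>sin x - sin y\<bar> \<le> \<bar>x - y :: real\<bar>"
proof -
  have "\<bar>sin x - sin y\<bar> = 2 * (\<bar>sin ((x - y) / 2)\<bar> * \<bar>cos ((x + y) / 2)\<bar>)"
    unfolding sin_diff_sin by (simp add: abs_mult)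
  also have "\<dots> \<le> 2 * (\<bar>(x - y) / 2\<bar> * 1)"
    by (intro mult_left_mono mult_mono abs_sin_x_le_abs_x) auto
  finally show ?thesis by simp
qed

lemma abs_wave_le:
  assumes "\<bar>A\<bar> \<le> R" "\<bar>B\<bar> \<le> R"
  shows "\<bar>wave (A, B, l, m) t s\<bar> \<le> 2 * R"
proof -
  let ?\<phi> = "l * real t + m * real s"
  have "\<bar>wave (A, B, l, m) t s\<bar> \<le> \<bar>A\<bar> * \<bar>cos ?\<phi>\<bar> + \<bar>B\<bar> * \<bar>sin ?\<phi>\<bar>"
    by (simp add: wave_def abs_mult[symmetric])
  also have "\<dots> \<le> R * 1 + R * 1"
    using assms by (intro add_mono mult_mono) auto
  finally show ?thesis by simp
qed

text \<open>The phase error is at most \<open>d * (t + s)\<close>, and sine and cosine are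
  Lipschitz. Only the unprimed amplitudes multiply a phase error, hence the asymmetric
  hypotheses.\<close>

lemma abs_wave_diff_le:
  assumes "\<bar>A\<bar> \<le> R" "\<bar>B\<bar> \<le> R" "\<bar>A - A'\<bar> \<le> d" "\<bar>B - B'\<bar> \<le> d" "\<bar>l - l'\<bar> \<le> d" "\<bar>m - m'\<bar> \<le> d"
  shows "\<bar>wave (A, B, l, m) t s - wave (A', B', l', m') t s\<bar> \<le> 2 * d * (1 + R * real (t + s))"
proof -
  let ?u = "l * real t + m * real s" and ?v = "l' * real t + m' * real s"
  have "\<bar>?u - ?v\<bar> = \<bar>(l - l') * real t + (m - m') * real s\<bar>" by (simp add: algebra_simps)
  also have "\<dots> \<le> \<bar>l - l'\<bar> * real t + \<bar>m - m'\<bar> * real s"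
    by (rule order_trans[OF abs_triangle_ineq]) (simp add: abs_mult)
  also have "\<dots> \<le> d * real t + d * real s"
    using assms by (intro add_mono mult_right_mono) auto
  finally have uv: "\<bar>?u - ?v\<bar> \<le> d * real (t + s)" by (simp add: algebra_simps)
  have "wave (A, B, l, m) t s - wave (A', B', l', m') t s =
      A * (cos ?u - cos ?v) + (A - A') * cos ?v + (B * (sin ?u - sin ?v) + (B - B') * sin ?v)"
    by (simp add: wave_def algebra_simps)
  also have "\<bar>\<dots>\<bar> \<le> \<bar>A\<bar> * \<bar>cos ?u - cos ?v\<bar> + \<bar>A - A'\<bar> * \<bar>cos ?v\<bar> +
      (\<bar>B\<bar> * \<bar>sin ?u - sin ?v\<bar> + \<bar>B - B'\<bar> * \<bar>sin ?v\<bar>)"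
    unfolding abs_mult[symmetric] by linarith
  also have "\<dots> \<le> R * (d * real (t + s)) + d * 1 + (R * (d * real (t + s)) + d * 1)"
    using assms
    by (intro add_mono mult_mono order_trans[OF abs_cos_diff_le uv] order_trans[OF abs_sin_diff_le uv]) auto
  finally show ?thesis by (simp add: algebra_simps)
qed

lemma abs_signal_le:
  fixes \<theta> :: "component ^ 'p"
  assumes "\<theta> \<in> coeff_box {- R..R}"
  shows "\<bar>signal \<theta> t s\<bar> \<le> real CARD('p) * (2 * R)"
proof -
  have "\<bar>wave (\<theta> $ k) t s\<bar> \<le> 2 * R" for k
  proof -
    obtain A B l m where k: "\<theta> $ k = (A, B, l, m)" by (metis prod_cases4)
    have "\<theta> $ k \<in> {- R..R} \<times> {- R..R} \<times> {- R..R} \<times> {- R..R}"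
      using assms unfolding coeff_box_def by blast
    then show ?thesis unfolding k by (intro abs_wave_le) auto
  qed
  then have "(\<Sum>k\<in>UNIV. \<bar>wave (\<theta> $ k) t s\<bar>) \<le> (\<Sum>k\<in>(UNIV::'p set). 2 * R)"
    by (intro sum_mono)
  then have "(\<Sum>k\<in>UNIV. \<bar>wave (\<theta> $ k) t s\<bar>) \<le> real CARD('p) * (2 * R)" by simp
  with sum_abs show ?thesis unfolding signal_def by (rule order_trans)
qed

text \<open>Every coordinate is rounded to the grid, and the wave estimate is applied with the mesh
  as \<open>d\<close>.\<close>

lemma signal_grid_approx:
  fixes \<theta> :: "component ^ 'p"
  assumes \<theta>: "\<theta> \<in> coeff_box {- real R..real R}" and N: "N \<ge> 1"
  shows "\<exists>\<theta>'\<in>(coeff_box (grid R N) :: (component ^ 'p) set). \<forall>t s. t + s \<le> N \<longrightarrow>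
    \<bar>signal \<theta> t s - signal \<theta>' t s\<bar> \<le> real CARD('p) * (2 * (1 + real R)) / real N"
proof -
  let ?d = "1 / (real N)\<^sup>2"
  obtain f where f: "\<And>x. \<bar>x\<bar> \<le> real R \<Longrightarrow> f x \<in> grid R N \<and> \<bar>x - f x\<bar> \<le> ?d"
    using grid_approx[OF _ N, of _ R] by metis
  define \<theta>' where "\<theta>' = (\<chi> k. case \<theta> $ k of (A, B, l, m) \<Rightarrow> (f A, f B, f l, f m))"
  have coords: "\<bar>A\<bar> \<le> real R" "\<bar>B\<bar> \<le> real R" "\<bar>l\<bar> \<le> real R" "\<bar>m\<bar> \<le> real R"
    if "\<theta> $ k = (A, B, l, m)" for k A B l m
  proof -
    have "\<theta> $ k \<in> {- real R..real R} \<times> {- real R..real R} \<times> {- real R..real R} \<times> {- real R..real R}"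
      using \<theta> unfolding coeff_box_def by blast
    then show "\<bar>A\<bar> \<le> real R" "\<bar>B\<bar> \<le> real R" "\<bar>l\<bar> \<le> real R" "\<bar>m\<bar> \<le> real R"
      unfolding that by auto
  qed
  have "\<theta>' \<in> coeff_box (grid R N)"
    unfolding coeff_box_def \<theta>'_def
  proof clarsimp
    fix k
    obtain A B l m where k: "\<theta> $ k = (A, B, l, m)" by (metis prod_cases4)
    show "(case \<theta> $ k of (A, B, l, m) \<Rightarrow> (f A, f B, f l, f m)) \<in> grid R N \<times> grid R N \<times> grid R N \<times> grid R N"
      unfolding k using coords[OF k] f by simp
  qed
  moreover have "\<bar>signal \<theta> t s - signal \<theta>' t s\<bar> \<le> real CARD('p) * (2 * (1 + real R)) / real N"
    if "t + s \<le> N" for t s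
  proof -
    have "\<bar>wave (\<theta> $ k) t s - wave (\<theta>' $ k) t s\<bar> \<le> 2 * (1 + real R) / real N" for k
    proof -
      obtain A B l m where k: "\<theta> $ k = (A, B, l, m)" by (metis prod_cases4)
      have "\<bar>wave (\<theta> $ k) t s - wave (\<theta>' $ k) t s\<bar> \<le> 2 * ?d * (1 + real R * real (t + s))"
      proof -
        have "\<theta>' $ k = (f A, f B, f l, f m)" by (simp add: \<theta>'_def k)
        then show ?thesis unfolding k
          by (simp only:) (rule abs_wave_diff_le; use coords[OF k] f in simp)
      qed
      also have "\<dots> \<le> 2 * ?d * (real N + real R * real N)"
        using that N by (intro mult_left_mono add_mono) auto
      also have "\<dots> = 2 * (1 + real R) / real N"
        using N by (simp add: field_simps power2_eq_square)
      finally show ?thesis .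
    qed
    then have "(\<Sum>k\<in>UNIV. \<bar>wave (\<theta> $ k) t s - wave (\<theta>' $ k) t s\<bar>) \<le>
        (\<Sum>k\<in>(UNIV::'p set). 2 * (1 + real R) / real N)"
      by (intro sum_mono)
    then have "(\<Sum>k\<in>UNIV. \<bar>wave (\<theta> $ k) t s - wave (\<theta>' $ k) t s\<bar>) \<le>
        real CARD('p) * (2 * (1 + real R)) / real N" by simp
    with sum_abs show ?thesis
      unfolding signal_def sum_subtractf[symmetric] by (rule order_trans)
  qed
  ultimately show ?thesis by (intro bexI[of _ \<theta>']) simp_all
qed

subsection \<open>Strong consistency\<close>

text \<open>The grid case carries over to the whole cube because \<open>excess\<close> and
  \<open>mean_excess\<close> are both 1-Lipschitz in the signal: \<open>\<eta> / 2\<close> on the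
  grid plus twice \<open>\<eta> / 4\<close> for rounding.\<close>

lemma (in prob_space) AE_uniform_law:
  fixes \<theta>\<^sub>0 :: "component ^ 'p"
  assumes indep: "indep_vars (\<lambda>_. borel) (\<lambda>(t, s). \<epsilon> t s) ({1..} \<times> {1..})"
    and distr: "\<And>t s. t \<ge> 1 \<Longrightarrow> s \<ge> 1 \<Longrightarrow> distr M borel (\<epsilon> t s) = P" and P: "real_distribution P"
    and \<theta>\<^sub>0: "\<theta>\<^sub>0 \<in> coeff_box {- real R..real R}" and "\<eta> > 0"
  shows "AE \<omega> in M. \<exists>N\<^sub>0. \<forall>T\<ge>1. \<forall>S\<ge>1. T + S \<ge> N\<^sub>0 \<longrightarrow> (\<forall>\<theta>\<in>(coeff_box {- real R..real R} :: (component ^ 'p) set).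
    \<bar>rect_mean T S (\<lambda>t s. excess (\<epsilon> t s \<omega>) (signal \<theta>\<^sub>0 t s - signal \<theta> t s) -
      mean_excess P (signal \<theta>\<^sub>0 t s - signal \<theta> t s))\<bar> < \<eta>)"
proof -
  interpret P: real_distribution P by (rule P)
  let ?p = "real CARD('p)"
  let ?F = "\<lambda>N. coeff_box (grid R N) :: (component ^ 'p) set"
  let ?h = "\<lambda>\<theta> t s. signal \<theta>\<^sub>0 t s - signal \<theta> t s"
  let ?Z = "\<lambda>\<omega> \<theta> t s. excess (\<epsilon> t s \<omega>) (?h \<theta> t s) - mean_excess P (?h \<theta> t s)"
  have F: "\<theta> \<in> coeff_box {- real R..real R}" if "\<theta> \<in> ?F N" for \<theta> N
    using that coeff_box_mono[OF grid_subset] by blast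
  have card: "real (card (?F N)) \<le> real ((2 * R + 1) ^ (4 * CARD('p))) * real N ^ (2 * (4 * CARD('p)))"
    if "N \<ge> 1" for N
  proof -
    have "card (?F N) \<le> ((2 * R + 1) * N\<^sup>2) ^ (4 * CARD('p))"
      by (rule order_trans[OF coeff_box_card(2)[OF finite_grid] power_mono[OF card_grid_le[OF that]]]) simp
    also have "\<dots> = (2 * R + 1) ^ (4 * CARD('p)) * N ^ (2 * (4 * CARD('p)))"
      by (simp only: power_mult_distrib power_mult)
    finally show ?thesis by (metis of_nat_le_iff of_nat_mult of_nat_power)
  qed
  \<comment> \<open>The added 1 makes the bound positive even for \<open>R = 0\<close>, as the
    deviation bound requires.\<close>
  have h: "\<bar>?h \<theta> t s\<bar> \<le> ?p * (4 * real R) + 1" if "\<theta> \<in> ?F N" for N \<theta> t s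
    using abs_signal_le[OF \<theta>\<^sub>0, of t s] abs_signal_le[OF F[OF that], of t s] by (simp add: algebra_simps)
  have "AE \<omega> in M. \<forall>\<^sub>F N in sequentially. \<forall>T\<ge>1. \<forall>S\<ge>1. T + S = N \<longrightarrow>
      (\<forall>\<theta>\<in>?F N. \<bar>rect_mean T S (?Z \<omega> \<theta>)\<bar> < \<eta> / 2)"
    by (rule AE_rect_mean_excess_less[OF indep distr coeff_box_card(1)[OF finite_grid] card h])
      (use \<open>\<eta> > 0\<close> in \<open>auto simp: add_nonneg_pos\<close>)
  then show ?thesis
  proof eventually_elim
    case (elim \<omega>)
    define C where "C = ?p * (2 * (1 + real R))"
    have "(\<lambda>N. C * inverse (real N)) \<longlonglongrightarrow> C * 0"
      by (intro tendsto_mult tendsto_const lim_inverse_n)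
    then have "(\<lambda>N. C / real N) \<longlonglongrightarrow> 0" by (simp add: divide_inverse)
    then have "\<forall>\<^sub>F N in sequentially. C / real N < \<eta> / 4"
      using \<open>\<eta> > 0\<close> by (intro order_tendstoD) auto
    with elim have "\<forall>\<^sub>F N in sequentially. N \<ge> 1 \<and> C / real N < \<eta> / 4 \<and> (\<forall>T\<ge>1. \<forall>S\<ge>1. T + S = N \<longrightarrow>
      (\<forall>\<theta>\<in>?F N. \<bar>rect_mean T S (?Z \<omega> \<theta>)\<bar> < \<eta> / 2))"
      using eventually_ge_at_top[of "1::nat"] by eventually_elim auto
    then obtain N\<^sub>0 where N\<^sub>0: "\<And>N. N \<ge> N\<^sub>0 \<Longrightarrow> N \<ge> 1 \<and> C / real N < \<eta> / 4 \<and> (\<forall>T\<ge>1. \<forall>S\<ge>1. T + S = N \<longrightarrow>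
      (\<forall>\<theta>\<in>?F N. \<bar>rect_mean T S (?Z \<omega> \<theta>)\<bar> < \<eta> / 2))"
      unfolding eventually_sequentially by blast
    have "\<bar>rect_mean T S (?Z \<omega> \<theta>)\<bar> < \<eta>"
      if TS: "T \<ge> 1" "S \<ge> 1" "T + S \<ge> N\<^sub>0" and \<theta>: "\<theta> \<in> coeff_box {- real R..real R}"
      for T S and \<theta> :: "component ^ 'p"
    proof -
      have N: "T + S \<ge> 1" "C / real (T + S) < \<eta> / 4"
        and less: "\<And>\<theta>. \<theta> \<in> ?F (T + S) \<Longrightarrow> \<bar>rect_mean T S (?Z \<omega> \<theta>)\<bar> < \<eta> / 2"
        using N\<^sub>0[OF TS(3)] TS by blast+
      obtain \<theta>' where \<theta>': "\<theta>' \<in> ?F (T + S)"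
        and close: "\<And>t s. t + s \<le> T + S \<Longrightarrow> \<bar>signal \<theta> t s - signal \<theta>' t s\<bar> \<le> C / real (T + S)"
        using signal_grid_approx[OF \<theta> N(1)] unfolding C_def by blast
      have "\<bar>rect_mean T S (?Z \<omega> \<theta>) - rect_mean T S (?Z \<omega> \<theta>')\<bar> =
          norm (rect_mean T S (\<lambda>t s. ?Z \<omega> \<theta> t s - ?Z \<omega> \<theta>' t s))"
        by (simp only: rect_mean_diff real_norm_def)
      also have "\<dots> \<le> rect_mean T S (\<lambda>t s. norm (?Z \<omega> \<theta> t s - ?Z \<omega> \<theta>' t s))"
        by (rule norm_rect_mean_le)
      also have "\<dots> \<le> rect_mean T S (\<lambda>_ _. \<eta> / 2)"
      proof (rule rect_mean_mono)
        fix t s assume "t \<in> {1..T}" "s \<in> {1..S}"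
        then have "\<bar>signal \<theta> t s - signal \<theta>' t s\<bar> \<le> C / real (T + S)"
          by (intro close) auto
        then have "\<bar>?h \<theta> t s - ?h \<theta>' t s\<bar> < \<eta> / 4"
          using N(2) by linarith
        moreover have "\<bar>?Z \<omega> \<theta> t s - ?Z \<omega> \<theta>' t s\<bar> \<le> \<bar>?h \<theta> t s - ?h \<theta>' t s\<bar> + \<bar>?h \<theta> t s - ?h \<theta>' t s\<bar>"
          using abs_excess_diff_le[of "\<epsilon> t s \<omega>" "?h \<theta> t s" "?h \<theta>' t s"]
            P.abs_mean_excess_diff_le[of "?h \<theta> t s" "?h \<theta>' t s"] by linarith
        ultimately show "norm (?Z \<omega> \<theta> t s - ?Z \<omega> \<theta>' t s) \<le> \<eta> / 2"
          unfolding real_norm_def by linarith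
      qed
      also have "\<dots> = \<eta> / 2" using TS by (simp add: rect_mean_const)
      finally show ?thesis using less[OF \<theta>'] by linarith
    qed
    then show ?case by blast
  qed
qed

lemma param_space_subset_coeff_box:
  assumes "compact K"
  shows "\<exists>R. (param_space K :: (component ^ 'p) set) \<subseteq> coeff_box {- real R..real R}"
proof -
  obtain B where B: "\<And>x. x \<in> K \<Longrightarrow> \<bar>x\<bar> \<le> B"
    using compact_imp_bounded[OF assms] by (auto simp: bounded_iff)
  \<comment> \<open>Here \<open>R\<close> also dominates \<open>pi\<close>, so that amplitudes and
    frequencies share one interval.\<close>
  obtain R where R: "real R \<ge> max B pi" using real_arch_simple by blast
  have "K \<subseteq> {- real R..real R}" "{0..pi} \<subseteq> {- real R..real R}"
    using B R by (force simp: abs_le_iff)+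
  then have "K \<times> K \<times> {0..pi} \<times> {0..pi} \<subseteq>
      {- real R..real R} \<times> {- real R..real R} \<times> {- real R..real R} \<times> {- real R..real R}"
    by (intro Sigma_mono)
  then show ?thesis
    unfolding param_space_def coeff_box_def
    by (intro exI[of _ R] Collect_mono allI impI) (rule subsetD, assumption, erule spec)
qed

text \<open>The residual at \<open>\<theta>\<close> is the error plus the difference of signals, and
  at \<open>\<theta>\<^sub>0\<close> it is the error itself.\<close>

lemma lad_objective_diff:
  assumes "\<And>t s. t \<ge> 1 \<Longrightarrow> s \<ge> 1 \<Longrightarrow> y t s = signal \<theta>\<^sub>0 t s + e t s"
  shows "lad_objective y T S \<theta> - lad_objective y T S \<theta>\<^sub>0 =
    rect_mean T S (\<lambda>t s. excess (e t s) (signal \<theta>\<^sub>0 t s - signal \<theta> t s))"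
proof -
  have obj: "lad_objective y T S \<theta> = rect_mean T S (\<lambda>t s. \<bar>y t s - signal \<theta> t s\<bar>)" for \<theta> :: "component ^ 'p"
    by (simp add: lad_objective_def rect_mean_def)
  show ?thesis
    unfolding obj rect_mean_diff[symmetric]
    by (rule rect_mean_cong) (simp add: assms excess_def algebra_simps)
qed

theorem theorem4p1:
  fixes M :: "'a measure"
    and K :: "real set"
    and \<theta>\<^sub>0 :: "component ^ 'p"
    and \<epsilon> y :: "nat \<Rightarrow> nat \<Rightarrow> 'a \<Rightarrow> real"
    and G g g' :: "real \<Rightarrow> real"
    and \<theta>hat :: "nat \<Rightarrow> nat \<Rightarrow> 'a \<Rightarrow> component ^ 'p"
  assumes "prob_space M"
    and p: "CARD('p) > 1"
    and model: "\<And>t s \<omega>. t \<ge> 1 \<Longrightarrow> s \<ge> 1 \<Longrightarrow> \<omega> \<in> space M \<Longrightarrow>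
          y t s \<omega> = signal \<theta>\<^sub>0 t s + \<epsilon> t s \<omega>"
    and genuine: "genuine_components \<theta>\<^sub>0"
    and K: "compact K"
    and interior: "\<theta>\<^sub>0 \<in> interior (param_space K)"
    and indep: "prob_space.indep_vars M (\<lambda>_. borel) (\<lambda>(t, s). \<epsilon> t s) ({1..} \<times> {1..})"
    and cdf: "\<And>t s. t \<ge> 1 \<Longrightarrow> s \<ge> 1 \<Longrightarrow> cdf (distr M borel (\<epsilon> t s)) = G"
    and density: "\<And>t s. t \<ge> 1 \<Longrightarrow> s \<ge> 1 \<Longrightarrow> distributed M lborel (\<epsilon> t s) (\<lambda>x. ennreal (g x))"
    and g_nonneg: "\<And>x. g x \<ge> 0"
    and g_cont: "continuous_on UNIV g"
    and median: "\<And>x. G x = 1 / 2 \<longleftrightarrow> x = 0"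
    and g_deriv: "\<And>x. (g has_real_derivative g' x) (at x)"
    and g'_bounded: "bounded (range g')"
    and second_moment: "\<And>t s. t \<ge> 1 \<Longrightarrow> s \<ge> 1 \<Longrightarrow> integrable M (\<lambda>\<omega>. (\<epsilon> t s \<omega>)\<^sup>2)"
    and lad: "\<And>T S \<omega>. T \<ge> 1 \<Longrightarrow> S \<ge> 1 \<Longrightarrow> \<omega> \<in> space M \<Longrightarrow>
          is_lad_estimate K (\<lambda>t s. y t s \<omega>) T S (\<theta>hat T S \<omega>)"
  shows "\<exists>\<pi>. (\<forall>T S \<omega>. bij (\<pi> T S \<omega>)) \<and>
          (AE \<omega> in M. ((\<lambda>(T, S). relabel (\<pi> T S \<omega>) (\<theta>hat T S \<omega>)) \<longlongrightarrow> \<theta>\<^sub>0)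
             (filtercomap (\<lambda>(T, S). min T S) at_top))"
proof -
  interpret prob_space M by fact
  define P where "P = distr M borel (\<epsilon> 1 1)"
  have rv: "random_variable borel (\<epsilon> t s)" if "t \<ge> 1" "s \<ge> 1" for t s
    using indep that unfolding indep_vars_def by fastforce
  have "real_distribution (distr M borel (\<epsilon> t s))" if "t \<ge> 1" "s \<ge> 1" for t s
    by (rule real_distribution_distr[OF rv[OF that]])
  \<comment> \<open>A distribution on the line is determined by its distribution function, so all
    errors share the law \<open>P\<close>.\<close>
  then have P: "real_distribution P" and distr: "\<And>t s. t \<ge> 1 \<Longrightarrow> s \<ge> 1 \<Longrightarrow> distr M borel (\<epsilon> t s) = P"
    unfolding P_def by (auto intro!: cdf_unique simp: cdf)
  interpret P: real_distribution P by (rule P)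
  have median_P: "Distribution_Functions.cdf P x = 1 / 2 \<longleftrightarrow> x = 0" for x
    unfolding P_def cdf[OF order_refl order_refl] by (rule median)
  obtain R where R: "(param_space K :: (component ^ 'p) set) \<subseteq> coeff_box {- real R..real R}"
    using param_space_subset_coeff_box[OF K] by blast
  have \<theta>\<^sub>0: "\<theta>\<^sub>0 \<in> param_space K" using interior interior_subset by blast
  define d where "d \<theta> \<pi> = dist (relabel \<pi> \<theta>) \<theta>\<^sub>0" for \<theta> and \<pi> :: "'p \<Rightarrow> 'p"
  \<comment> \<open>Choosing the closest relabelling fixes \<open>\<pi>\<close> before any
    tolerance; a permutation taken from the identification argument would depend on
    \<open>\<delta>\<close>.\<close>
  define \<pi> where "\<pi> T S \<omega> = arg_min_on (d (\<theta>hat T S \<omega>)) {\<pi>. bij \<pi>}" for T S \<omega>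
  have fin: "finite {\<pi> :: 'p \<Rightarrow> 'p. bij \<pi>}" by simp
  have ne: "{\<pi> :: 'p \<Rightarrow> 'p. bij \<pi>} \<noteq> {}" using bij_id by blast
  have bij: "bij (\<pi> T S \<omega>)" for T S \<omega>
    using arg_min_if_finite(1)[OF fin ne] unfolding \<pi>_def by blast
  have \<pi>_le: "d (\<theta>hat T S \<omega>) (\<pi> T S \<omega>) \<le> d (\<theta>hat T S \<omega>) \<sigma>" if "bij \<sigma>" for T S \<omega> \<sigma>
    unfolding \<pi>_def using arg_min_least[OF fin ne, of \<sigma>] that by blast
  let ?h = "\<lambda>\<theta> t s. signal \<theta>\<^sub>0 t s - signal \<theta> t s"
  \<comment> \<open>Only the countably many tolerances \<open>1 / (n + 1)\<close> are taken, so that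
    one null set serves them all.\<close>
  have "AE \<omega> in M. \<forall>n. \<exists>N\<^sub>0. \<forall>T\<ge>1. \<forall>S\<ge>1. T + S \<ge> N\<^sub>0 \<longrightarrow> (\<forall>\<theta>\<in>(coeff_box {- real R..real R} :: (component ^ 'p) set).
    \<bar>rect_mean T S (\<lambda>t s. excess (\<epsilon> t s \<omega>) (?h \<theta> t s) - mean_excess P (?h \<theta> t s))\<bar> < inverse (real (Suc n)))"
    unfolding AE_all_countable
    by (intro allI AE_uniform_law[OF indep distr P]) (use R \<theta>\<^sub>0 in auto)
  then have "AE \<omega> in M. ((\<lambda>(T, S). relabel (\<pi> T S \<omega>) (\<theta>hat T S \<omega>)) \<longlongrightarrow> \<theta>\<^sub>0)
             (filtercomap (\<lambda>(T, S). min T S) at_top)"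
    using AE_space
  proof eventually_elim
    case (elim \<omega>)
    show ?case
    proof (rule tendstoI)
      fix \<delta> :: real assume "\<delta> > 0"
      \<comment> \<open>The constants are chosen in the order \<open>\<kappa>\<close>,
        \<open>C\<close>, \<open>n\<close>, \<open>N\<^sub>0\<close>; only the last depends on the
        outcome. They are tuned so that
        \<open>\<kappa> / 2 + C * (\<kappa> / (2 * C)) = \<kappa>\<close>.\<close>
      obtain \<kappa> N\<^sub>1 where "\<kappa> > 0" and id: "\<And>T S \<theta>. T \<ge> N\<^sub>1 \<Longrightarrow> S \<ge> N\<^sub>1 \<Longrightarrow> \<theta> \<in> param_space K \<Longrightarrow>
          rect_mean T S (\<lambda>t s. (?h \<theta> t s)\<^sup>2) \<le> \<kappa> \<Longrightarrow> \<exists>\<pi>. bij \<pi> \<and> d \<theta> \<pi> < \<delta>"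
        using identification[OF K interior genuine \<open>\<delta> > 0\<close>] unfolding d_def by blast
      obtain C where "C > 0" and C: "\<And>h. \<bar>h\<bar> \<le> real CARD('p) * (4 * real R) \<Longrightarrow>
          h\<^sup>2 \<le> \<kappa> / 2 + C * mean_excess P h"
        using P.square_le_mean_excess[OF median_P, of "\<kappa> / 2"] \<open>\<kappa> > 0\<close> by (meson half_gt_zero)
      have "\<kappa> / (2 * C) > 0" using \<open>\<kappa> > 0\<close> \<open>C > 0\<close> by simp
      then obtain n where n: "inverse (real (Suc n)) < \<kappa> / (2 * C)" using reals_Archimedean by blast
      obtain N\<^sub>0 where N\<^sub>0: "\<And>T S (\<theta> :: component ^ 'p). T \<ge> 1 \<Longrightarrow> S \<ge> 1 \<Longrightarrow> T + S \<ge> N\<^sub>0 \<Longrightarrow> \<theta> \<in> coeff_box {- real R..real R} \<Longrightarrow>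
          \<bar>rect_mean T S (\<lambda>t s. excess (\<epsilon> t s \<omega>) (?h \<theta> t s) - mean_excess P (?h \<theta> t s))\<bar> < inverse (real (Suc n))"
        using elim(1) by blast
      have main: "dist (relabel (\<pi> T S \<omega>) (\<theta>hat T S \<omega>)) \<theta>\<^sub>0 < \<delta>"
        if TS: "T \<ge> max 1 (max N\<^sub>0 N\<^sub>1)" "S \<ge> max 1 (max N\<^sub>0 N\<^sub>1)" for T S
      proof -
        let ?\<theta> = "\<theta>hat T S \<omega>"
        have TS': "T \<ge> 1" "S \<ge> 1" "T + S \<ge> N\<^sub>0" "T \<ge> N\<^sub>1" "S \<ge> N\<^sub>1" using TS by auto
        have est: "?\<theta> \<in> param_space K" "lad_objective (\<lambda>t s. y t s \<omega>) T S ?\<theta> \<le> lad_objective (\<lambda>t s. y t s \<omega>) T S \<theta>\<^sub>0"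
          using lad[OF TS'(1,2) elim(2)] \<theta>\<^sub>0 unfolding is_lad_estimate_def is_arg_min_linorder by auto
        then have box: "?\<theta> \<in> coeff_box {- real R..real R}" using R by blast
        \<comment> \<open>The true parameter is admissible, so the estimate does at least as well
          and its sample mean of excesses is at most 0.\<close>
        have "rect_mean T S (\<lambda>t s. excess (\<epsilon> t s \<omega>) (?h ?\<theta> t s)) \<le> 0"
          using est(2) lad_objective_diff[of "\<lambda>t s. y t s \<omega>" \<theta>\<^sub>0 "\<lambda>t s. \<epsilon> t s \<omega>" T S ?\<theta>] model[OF _ _ elim(2)]
          by simp
        \<comment> \<open>The expected excess is evaluated at a random parameter; uniformity of the
          law over the cube permits this.\<close>
        with N\<^sub>0[OF TS'(1-3) box] have "rect_mean T S (\<lambda>t s. mean_excess P (?h ?\<theta> t s)) < inverse (real (Suc n))"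
          unfolding rect_mean_diff by linarith
        then have "rect_mean T S (\<lambda>t s. mean_excess P (?h ?\<theta> t s)) < \<kappa> / (2 * C)" using n by linarith
        then have small: "C * rect_mean T S (\<lambda>t s. mean_excess P (?h ?\<theta> t s)) < \<kappa> / 2"
          using \<open>C > 0\<close> by (simp add: field_simps)
        have "rect_mean T S (\<lambda>t s. (?h ?\<theta> t s)\<^sup>2) \<le> rect_mean T S (\<lambda>t s. \<kappa> / 2 + C * mean_excess P (?h ?\<theta> t s))"
        proof (rule rect_mean_mono, rule C)
          fix t s
          show "\<bar>?h ?\<theta> t s\<bar> \<le> real CARD('p) * (4 * real R)"
            using abs_signal_le[OF box, of t s] abs_signal_le[of \<theta>\<^sub>0 "real R" t s] R \<theta>\<^sub>0 by fastforce
        qed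
        also have "\<dots> = \<kappa> / 2 + C * rect_mean T S (\<lambda>t s. mean_excess P (?h ?\<theta> t s))"
          by (simp only: rect_mean_add rect_mean_mult_left rect_mean_const[OF TS'(1,2)])
        finally have "rect_mean T S (\<lambda>t s. (?h ?\<theta> t s)\<^sup>2) \<le> \<kappa>" using small by linarith
        from id[OF TS'(4,5) est(1) this] obtain \<sigma> where "bij \<sigma>" "d ?\<theta> \<sigma> < \<delta>" by blast
        \<comment> \<open>The closest relabelling does at least as well as the permutation
          \<open>\<sigma>\<close> supplied by identification.\<close>
        then show ?thesis using \<pi>_le[of \<sigma> T S \<omega>] unfolding d_def by linarith
      qed
      show "\<forall>\<^sub>F x in filtercomap (\<lambda>(T, S). min T S) at_top.
          dist (case x of (T, S) \<Rightarrow> relabel (\<pi> T S \<omega>) (\<theta>hat T S \<omega>)) \<theta>\<^sub>0 < \<delta>"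
        unfolding eventually_filtercomap eventually_at_top_linorder
        by (intro exI[of _ "\<lambda>n. n \<ge> max 1 (max N\<^sub>0 N\<^sub>1)"] conjI exI[of _ "max 1 (max N\<^sub>0 N\<^sub>1)"])
          (auto intro: main)
    qed
  qed
  with bij show ?thesis by blast
qed

end
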